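(* Let $d\in\mathbb N$, $\alpha\in\mathbb R$, $\alpha\ne0$, let $\mathcal H_X,\mathcal H_Y$ be (finite- or infinite-dimensional) separable complex Hilbert spaces, let $\omega(j)=(1+|j|)^s$, $j\in\mathbb Z^d$, with $s>(d+1)^2$, and let $\mathbb A=(a_{mn})_{m,n\in\mathbb Z^d}$, $a_{mn}:\mathcal H_X\to\mathcal H_Y$, be an operator matrix in $\Sigma^\omega_\alpha$ that is bounded below in $\ell^p$ for some $p\in[1,\infty]$. Then for every $q\in[1,\infty]$ the image $\operatorname{Im}\mathbb A=\mathbb A\,\ell^q(\mathbb Z^d,\mathcal H_X)$ is a complementable subspace of $\ell^q(\mathbb Z^d,\mathcal H_Y)$.
   Context: For $n\in\mathbb Z^d$, $|n|=\max_{1\le k\le d}|n_k|$. For a Hilbert space $\mathcal H$, $\ell^p(\mathbb Z^d,\mathcal H)$ is the Banach space of sequences $x=(x_n)_{n\in\mathbb Z^d}$ in $\mathcal H$ with norm $\|x\|_p=(\sum_n\|x_n\|^p)^{1/p}$ ($1\le p<\infty$), $\|x\|_\infty=\sup_n\|x_n\|$. An operator matrix $\mathbb A=(a_{mn})_{m,n\in\mathbb Z^d}$ consists of bounded linear operators $a_{mn}:\mathcal H_X\to\mathcal H_Y$; $\|\mathbb A\|_{\sup}=\sup_{m,n}\|a_{mn}\|$. For $\alpha\ne0$ and $j\in\mathbb Z^d$ the $j$-th $\alpha$-slant of $\mathbb A$ is $A_j=(a^{(j)}_{mn})$ with $a^{(j)}_{mn}=a_{mn}\prod_{k=1}^d\chi_{[j_k,j_k+1)}(\alpha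 m_k-n_k)$. Let $K=\lceil|\alpha|^{-1}\rceil^d$. $\Sigma^\omega_\alpha$ is the class of matrices with $\|\mathbb A\|_{\Sigma^\omega_\alpha}=K\sum_{j}\|A_j\|_{\sup}\omega(j)<\infty$. Every $\mathbb A\in\Sigma^\omega_\alpha$ defines, by $(\mathbb Ax)_m=\sum_na_{mn}x_n$, a bounded operator $\ell^p(\mathbb Z^d,\mathcal H_X)\to\ell^p(\mathbb Z^d,\mathcal H_Y)$ for all $p\in[1,\infty]$. $\mathbb A$ is bounded below in $\ell^p$ if there is $\kappa_p>0$ with $\|\mathbb Ax\|_p\ge\kappa_p\|x\|_p$ for all $x\in\ell^p(\mathbb Z^d,\mathcal H_X)$. A subspace of a Banach space is complementable if it is the range of a bounded projection. *)

theory Defs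
  imports "HOL-Analysis.Analysis"
begin

class scaleC =
  fixes scaleC :: "complex \<Rightarrow> 'a \<Rightarrow> 'a"  (infixr "*\<^sub>C" 75)

class complex_vector = real_vector + scaleC +
  assumes scaleC_add_right: "c *\<^sub>C (x + y) = c *\<^sub>C x + c *\<^sub>C y"
    and scaleC_add_left: "(b + c) *\<^sub>C x = b *\<^sub>C x + c *\<^sub>C x"
    and scaleC_scaleC: "b *\<^sub>C (c *\<^sub>C x) = (b * c) *\<^sub>C x"
    and scaleC_of_real: "complex_of_real r *\<^sub>C x = r *\<^sub>R x"

(* The complex inner product is linear in its first argument.  Its real part is the
   library's real inner product, from which positive definiteness and
   norm x = sqrt (cinner x x) are inherited. *)
class complex_inner = complex_vector + real_inner +
  fixes cinner :: "'a \<Rightarrow> 'a \<Rightarrow> complex"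
  assumes cinner_commute: "cinner x y = cnj (cinner y x)"
    and cinner_add_left: "cinner (x + y) z = cinner x z + cinner y z"
    and cinner_scaleC_left: "cinner (c *\<^sub>C x) y = c * cinner x y"
    and Re_cinner: "Re (cinner x y) = inner x y"

class complex_hilbert = complex_inner + banach

instantiation complex :: complex_hilbert
begin

definition scaleC_complex :: "complex \<Rightarrow> complex \<Rightarrow> complex"
  where "scaleC_complex c z = c * z"

definition cinner_complex :: "complex \<Rightarrow> complex \<Rightarrow> complex"
  where "cinner_complex z w = z * cnj w"

instance
  by standard
    (auto simp: scaleC_complex_def cinner_complex_def inner_complex_def algebra_simps
      scaleR_conv_of_real)

end

definition bounded_clinear :: "('a::complex_hilbert \<Rightarrow> 'b::complex_hilbert) \<Rightarrow> bool"
  where "bounded_clinear f \<longleftrightarrow> bounded_linear f \<and> (\<forall>c x. f (c *\<^sub>C x) = c *\<^sub>C f x)"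

(* Z^d is the type int ^ 'd, with d = CARD('d). *)
definition max_abs :: "int ^ 'd \<Rightarrow> int"
  where "max_abs n = Max (range (\<lambda>k. \<bar>n $ k\<bar>))"

definition poly_weight :: "real \<Rightarrow> int ^ 'd \<Rightarrow> real"
  where "poly_weight s j = (1 + real_of_int (max_abs j)) powr s"

definition lp :: "ereal \<Rightarrow> (int ^ 'd \<Rightarrow> 'a::complex_hilbert) set"
  where "lp p = (if p = \<infinity> then {x. bounded (range x)}
                 else {x. (\<lambda>n. norm (x n) powr real_of_ereal p) summable_on UNIV})"

definition lp_norm :: "ereal \<Rightarrow> (int ^ 'd \<Rightarrow> 'a::complex_hilbert) \<Rightarrow> real"
  where "lp_norm p x =
    (if p = \<infinity> then (SUP n. norm (x n))
     else (\<Sum>\<^sub>\<infinity>n. norm (x n) powr real_of_ereal p) powr (1 / real_of_ereal p))"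

type_synonym ('d, 'x, 'y) op_matrix = "int ^ 'd \<Rightarrow> int ^ 'd \<Rightarrow> 'x \<Rightarrow> 'y"

definition sup_norm ::
    "('d::finite, 'x::complex_hilbert, 'y::complex_hilbert) op_matrix \<Rightarrow> ennreal"
  where "sup_norm A = (SUP m. SUP n. ennreal (onorm (A m n)))"

definition slant ::
    "real \<Rightarrow> int ^ 'd \<Rightarrow> ('d::finite, 'x, 'y::complex_hilbert) op_matrix \<Rightarrow> ('d, 'x, 'y) op_matrix"
  where "slant \<alpha> j A m n v =
    (\<Prod>k\<in>UNIV. indicator {real_of_int (j $ k)..<real_of_int (j $ k) + 1}
                  (\<alpha> * real_of_int (m $ k) - real_of_int (n $ k))) *\<^sub>R A m n v"

definition slant_norm ::
    "real \<Rightarrow> (int ^ 'd \<Rightarrow> real)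
      \<Rightarrow> ('d::finite, 'x::complex_hilbert, 'y::complex_hilbert) op_matrix \<Rightarrow> ennreal"
  where "slant_norm \<alpha> \<omega> A =
    of_nat (nat \<lceil>1 / \<bar>\<alpha>\<bar>\<rceil> ^ CARD('d)) * (\<Sum>\<^sub>\<infinity>j. sup_norm (slant \<alpha> j A) * ennreal (\<omega> j))"

definition slant_class ::
    "real \<Rightarrow> (int ^ 'd \<Rightarrow> real)
      \<Rightarrow> ('d::finite, 'x::complex_hilbert, 'y::complex_hilbert) op_matrix set"
  where "slant_class \<alpha> \<omega> = {A. (\<forall>m n. bounded_clinear (A m n)) \<and> slant_norm \<alpha> \<omega> A < \<infinity>}"

definition mat_apply ::
    "('d::finite, 'x::complex_hilbert, 'y::complex_hilbert) op_matrix
      \<Rightarrow> (int ^ 'd \<Rightarrow> 'x) \<Rightarrow> (int ^ 'd \<Rightarrow> 'y)"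
  where "mat_apply A x m = (\<Sum>\<^sub>\<infinity>n. A m n (x n))"

definition bounded_below_lp ::
    "ereal \<Rightarrow> ('d::finite, 'x::complex_hilbert, 'y::complex_hilbert) op_matrix \<Rightarrow> bool"
  where "bounded_below_lp p A \<longleftrightarrow>
    (\<exists>\<kappa>>0. \<forall>x\<in>lp p. lp_norm p (mat_apply A x) \<ge> \<kappa> * lp_norm p x)"

(* Only the values of P on lp p matter. *)
definition bounded_projection_lp ::
    "ereal \<Rightarrow> ((int ^ 'd \<Rightarrow> 'a::complex_hilbert) \<Rightarrow> (int ^ 'd \<Rightarrow> 'a)) \<Rightarrow> bool"
  where "bounded_projection_lp p P \<longleftrightarrow>
    P ` lp p \<subseteq> lp p \<and>
    (\<forall>x\<in>lp p. \<forall>y\<in>lp p. P (\<lambda>n. x n + y n) = (\<lambda>n. P x n + P y n)) \<and>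
    (\<forall>c. \<forall>x\<in>lp p. P (\<lambda>n. c *\<^sub>C x n) = (\<lambda>n. c *\<^sub>C P x n)) \<and>
    (\<exists>C. \<forall>x\<in>lp p. lp_norm p (P x) \<le> C * lp_norm p x) \<and>
    (\<forall>x\<in>lp p. P (P x) = P x)"

definition complementable_lp :: "ereal \<Rightarrow> (int ^ 'd \<Rightarrow> 'a::complex_hilbert) set \<Rightarrow> bool"
  where "complementable_lp p S \<longleftrightarrow> (\<exists>P. bounded_projection_lp p P \<and> P ` lp p = S)"

end

theory Submission
  imports Defs
begin

text \<open>The range of \<open>A\<close> on \<open>l^q\<close> is complemented as soon as \<open>A\<close> has a left inverse \<open>B\<close> that is
  bounded on every \<open>l^q\<close>: then \<open>A B\<close> is a projection onto the range. A left inverse matrix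
  with a Schur kernel suffices, and it is produced by least squares in \<open>l^2\<close>.

  Both analytic steps rest on one device. Let \<open>W x = (\<Prod>k. (1 + \<bar>x_k\<bar>)^2)\<close>. The hypothesis on
  \<open>s\<close> gives \<open>s > (d+1)^2 \<ge> 4 d\<close>, hence \<open>\<parallel>a_{mn}\<parallel> \<le> C / W(\<alpha>m - n)^2\<close>. For a center \<open>z\<close> put
  \<open>u(x) = 1 / W(\<epsilon>(x - z))\<close>, a cutoff that is used on the columns at the points \<open>n\<close> and on the rows
  at the points \<open>\<alpha>m\<close>. Conjugating \<open>A\<close> by \<open>u\<close> multiplies \<open>a_{mn}\<close> by \<open>u(\<alpha>m) / u(n)\<close>, which differs
  from \<open>1\<close> by at most \<open>\<epsilon> W(\<alpha>m - n)\<close> (\<open>cutoff_ratio\<close>). So the conjugated matrix differs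
  from \<open>A\<close> by a matrix with kernel \<open>\<epsilon> C / W(\<alpha>m - n)\<close>, whose norm on every \<open>l^p\<close> is \<open>O(\<epsilon>)\<close>
  by the Schur test, uniformly in \<open>z\<close>. For small \<open>\<epsilon>\<close> a lower bound for \<open>A\<close> therefore passes to the
  weighted spaces, with a constant that does not depend on \<open>z\<close>.

  Stability (\<open>stability_pointwise\<close>): the weighted lower bound in \<open>l^p\<close>, with the
  center \<open>z = i\<close>, gives \<open>\<parallel>x_i\<parallel> \<le> \<parallel>u x\<parallel>_p \<le> const * \<parallel>u A x\<parallel>_p \<le> const * \<parallel>u A x\<parallel>_1\<close>. The right-hand
  side is a Schur kernel applied to \<open>\<parallel>(A x)_m\<parallel>\<close>, so \<open>A\<close> is bounded below in every \<open>l^q\<close>, in particular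
  in \<open>l^2\<close>.

  Localisation (\<open>weighted_least_squares\<close>, \<open>left_inverse_exists\<close>): in \<open>l^2\<close> let \<open>x = B y\<close>
  be the solution of \<open>\<langle>A x - y, A z\<rangle> = 0\<close> for all \<open>z\<close>. Testing with \<open>z = u^2 x\<close> and
  conjugating gives \<open>\<parallel>u B y\<parallel> \<le> const * \<parallel>u y\<parallel>\<close>. If \<open>y\<close> lives at the single row \<open>m\<close>, this says that
  the entry \<open>(i, m)\<close> of \<open>B\<close> is at most \<open>const / W(\<alpha>m - i)\<close>. Thus \<open>B\<close> has a Schur kernel, and
  \<open>B A = 1\<close> extends from \<open>l^2\<close> to all bounded sequences by exchanging two absolutely
  convergent sums.\<close>

section \<open>A submultiplicative weight on real vectors\<close>

text \<open>A product over the coordinates instead of a norm: sums over the lattice then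
  factor into one-dimensional sums. The exponent 2 is the least integer that makes those
  converge.\<close>
definition weight :: "real ^ 'd \<Rightarrow> real"
  where "weight x = (\<Prod>k\<in>UNIV. (1 + \<bar>x $ k\<bar>)\<^sup>2)"

definition node :: "real \<Rightarrow> int ^ 'd \<Rightarrow> real ^ 'd"
  where "node \<beta> n = (\<chi> k. \<beta> * of_int (n $ k))"

lemma weight_ge_1: "1 \<le> weight (x :: real ^ 'd::finite)"
  unfolding weight_def by (intro prod_ge_1) (auto intro!: one_le_power)

lemma weight_pos: "0 < weight (x :: real ^ 'd::finite)"
  using weight_ge_1[of x] by linarith

lemma weight_0 [simp]: "weight (0 :: real ^ 'd::finite) = 1"
  by (simp add: weight_def)

lemma weight_minus [simp]: "weight (- x :: real ^ 'd::finite) = weight x"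
  by (simp add: weight_def)

lemma weight_diff_commute: "weight (x - y :: real ^ 'd::finite) = weight (y - x)"
  by (metis minus_diff_eq weight_minus)

lemma weight_add_le: "weight (x + y :: real ^ 'd::finite) \<le> weight x * weight y"
proof -
  have "(1 + \<bar>x $ k + y $ k\<bar>)\<^sup>2 \<le> (1 + \<bar>x $ k\<bar>)\<^sup>2 * (1 + \<bar>y $ k\<bar>)\<^sup>2" for k
  proof -
    have "1 + \<bar>x $ k + y $ k\<bar> \<le> (1 + \<bar>x $ k\<bar>) * (1 + \<bar>y $ k\<bar>)"
      using abs_triangle_ineq[of "x $ k" "y $ k"] mult_nonneg_nonneg[OF abs_ge_zero[of "x $ k"] abs_ge_zero[of "y $ k"]]
      unfolding distrib_left distrib_right by linarith
    then show ?thesis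
      by (metis abs_ge_zero add_nonneg_nonneg power_mono power_mult_distrib zero_le_one)
  qed
  then show ?thesis
    unfolding weight_def prod.distrib[symmetric]
    by (intro prod_mono) auto
qed

text \<open>The left-hand side is a polynomial in \<open>\<epsilon>\<close> with nonnegative coefficients and no constant
  term, hence convex and zero at \<open>0\<close>.\<close>
lemma prod_one_plus_scaled_le:
  fixes a :: "'k \<Rightarrow> real"
  assumes "finite K" "\<And>k. k \<in> K \<Longrightarrow> 0 \<le> a k" "0 \<le> \<epsilon>" "\<epsilon> \<le> 1"
  shows "(\<Prod>k\<in>K. 1 + \<epsilon> * a k) - 1 \<le> \<epsilon> * ((\<Prod>k\<in>K. 1 + a k) - 1)"
  using assms(1,2)
proof (induction K rule: finite_induct)
  case (insert k K)
  define Q where "Q = (\<Prod>k\<in>K. 1 + a k) - 1"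
  have Q: "0 \<le> Q"
    unfolding Q_def using insert.prems prod_ge_1[of K "\<lambda>k. 1 + a k"] by auto
  have a: "0 \<le> a k" using insert.prems by auto
  have "(\<Prod>k\<in>K. 1 + \<epsilon> * a k) \<le> 1 + \<epsilon> * Q"
    using insert unfolding Q_def by auto
  then have "(1 + \<epsilon> * a k) * (\<Prod>k\<in>K. 1 + \<epsilon> * a k) \<le> (1 + \<epsilon> * a k) * (1 + \<epsilon> * Q)"
    using a assms(3) by (intro mult_left_mono) auto
  also have "\<dots> = 1 + \<epsilon> * a k + \<epsilon> * Q + \<epsilon> * (\<epsilon> * (a k * Q))"
    by (simp add: algebra_simps)
  also have "\<dots> \<le> 1 + \<epsilon> * a k + \<epsilon> * Q + \<epsilon> * (1 * (a k * Q))"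
    using a Q assms(3,4) by (intro add_mono mult_mono mult_right_mono) auto
  finally show ?case
    using insert.hyps unfolding Q_def by (simp add: algebra_simps)
qed auto

lemma weight_scaled_le:
  fixes x :: "real ^ 'd::finite"
  assumes "0 \<le> \<epsilon>" "\<epsilon> \<le> 1"
  shows "weight (\<epsilon> *\<^sub>R x) - 1 \<le> \<epsilon> * (weight x - 1)"
proof -
  \<comment> \<open>Each coordinate is listed twice, so that the square becomes a plain product.\<close>
  define a where "a = (\<lambda>(k, b::bool). \<bar>x $ k\<bar>)"
  have pr: "weight (c *\<^sub>R x) = (\<Prod>z\<in>UNIV. 1 + c * a z)" if "0 \<le> c" for c
  proof -
    have "weight (c *\<^sub>R x) = (\<Prod>k\<in>UNIV. \<Prod>b\<in>UNIV. 1 + c * a (k, b))"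
      using that by (simp add: weight_def a_def abs_mult UNIV_bool power2_eq_square)
    also have "\<dots> = (\<Prod>(k, b)\<in>UNIV \<times> UNIV. 1 + c * a (k, b))"
      by (rule prod.cartesian_product)
    finally show ?thesis by (simp add: case_prod_beta)
  qed
  show ?thesis
    using prod_one_plus_scaled_le[of "UNIV" a \<epsilon>] pr[of \<epsilon>] pr[of 1] assms
    by (auto simp: a_def case_prod_beta)
qed

lemma weight_scaled_ge:
  fixes x :: "real ^ 'd::finite"
  assumes "0 < \<epsilon>" "\<epsilon> \<le> 1"
  shows "\<epsilon> ^ (2 * CARD('d)) * weight x \<le> weight (\<epsilon> *\<^sub>R x)"
proof -
  have "\<epsilon> ^ (2 * CARD('d)) * weight x = (\<Prod>k\<in>UNIV. (\<epsilon> * (1 + \<bar>x $ k\<bar>))\<^sup>2)"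
    by (simp add: weight_def power_mult_distrib prod.distrib power_mult)
  also have "\<dots> \<le> weight (\<epsilon> *\<^sub>R x)"
    unfolding weight_def using assms
    by (intro prod_mono conjI power_mono) (auto simp: algebra_simps abs_mult)
  finally show ?thesis .
qed

lemma inverse_square_summable_int: "(\<lambda>l::int. 1 / (1 + \<bar>real_of_int l\<bar>)\<^sup>2) summable_on UNIV"
proof -
  have *: "(\<lambda>n::nat. 1 / (1 + real n)\<^sup>2) summable_on UNIV"
  proof -
    have "summable (\<lambda>n::nat. inverse ((real (Suc n))\<^sup>2))"
      using inverse_power_summable[of 2, where 'a=real]
        summable_Suc_iff[of "\<lambda>n. inverse ((real n)\<^sup>2)"] by simp
    then have "summable (\<lambda>n::nat. 1 / (1 + real n)\<^sup>2)"
      by (simp add: inverse_eq_divide add.commute)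
    then show ?thesis
      by (subst summable_on_UNIV_nonneg_real_iff) auto
  qed
  have 1: "(\<lambda>l::int. 1 / (1 + \<bar>real_of_int l\<bar>)\<^sup>2) summable_on range int"
    using * by (subst summable_on_reindex) (auto simp: o_def)
  have 2: "(\<lambda>l::int. 1 / (1 + \<bar>real_of_int l\<bar>)\<^sup>2) summable_on range (\<lambda>n. - int n)"
    using * by (subst summable_on_reindex) (auto simp: o_def inj_def)
  have "UNIV = range int \<union> range (\<lambda>n. - int n)"
    by (auto simp: image_def) (metis int_cases2)
  then show ?thesis
    using summable_on_union[OF 1 2] by simp
qed

text \<open>If \<open>r\<close> is the integer nearest to \<open>z / \<beta>\<close>, then \<open>1 + \<bar>\<beta> l - z\<bar>\<close> is at least \<open>c (1 + \<bar>l - r\<bar>)\<close>, so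
  the sum is compared with a translate of \<open>\<Sum>l. 1 / (1 + \<bar>l\<bar>)^2\<close>.\<close>
lemma sum_line_bounded:
  assumes "\<beta> \<noteq> 0"
  obtains S where "0 < S"
    "\<And>z F. finite F \<Longrightarrow> (\<Sum>l\<in>F. 1 / (1 + \<bar>\<beta> * real_of_int l - z\<bar>)\<^sup>2) \<le> S"
proof
  define c where "c = min 1 \<bar>\<beta>\<bar> / 2"
  have c: "0 < c" "c \<le> 1/2" "2 * c \<le> \<bar>\<beta>\<bar>"
    using assms by (auto simp: c_def)
  define T where "T = (\<Sum>\<^sub>\<infinity>l::int. 1 / (1 + \<bar>real_of_int l\<bar>)\<^sup>2)"
  have "0 \<le> T" unfolding T_def by (intro infsum_nonneg) auto
  then show "0 < T / c\<^sup>2 + 1" using c by (smt (verit) divide_nonneg_nonneg zero_le_power2)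
  fix z :: real and F :: "int set" assume F: "finite F"
  define r where "r = round (z / \<beta>)"
  have le: "1 / (1 + \<bar>\<beta> * real_of_int l - z\<bar>)\<^sup>2 \<le> (1 / (1 + \<bar>real_of_int (l - r)\<bar>)\<^sup>2) / c\<^sup>2" for l
  proof -
    have "\<bar>real_of_int (l - r)\<bar> - 1/2 \<le> \<bar>real_of_int l - z / \<beta>\<bar>"
      using of_int_round_abs_le[of "z / \<beta>"] unfolding r_def by (simp add: abs_if split: if_splits)
    then have "2 * c * (\<bar>real_of_int (l - r)\<bar> - 1/2) \<le> 2 * c * \<bar>real_of_int l - z / \<beta>\<bar>"
      using c by (intro mult_left_mono) auto
    also have "\<dots> \<le> \<bar>\<beta>\<bar> * \<bar>real_of_int l - z / \<beta>\<bar>"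
      using c by (intro mult_right_mono) auto
    also have "\<dots> = \<bar>\<beta> * real_of_int l - z\<bar>"
      using assms by (simp add: abs_mult[symmetric] algebra_simps)
    finally have 1: "c * (1 + \<bar>real_of_int (l - r)\<bar>) \<le> 1 + \<bar>\<beta> * real_of_int l - z\<bar>"
      using c mult_nonneg_nonneg[of c "\<bar>real_of_int (l - r)\<bar>"] by (simp add: algebra_simps)
    have "0 < c * (1 + \<bar>real_of_int (l - r)\<bar>)" using c by (simp add: add_pos_nonneg)
    with 1 have "1 / (1 + \<bar>\<beta> * real_of_int l - z\<bar>)\<^sup>2 \<le> 1 / (c * (1 + \<bar>real_of_int (l - r)\<bar>))\<^sup>2"
      by (intro divide_left_mono power_mono mult_pos_pos[OF zero_less_power zero_less_power]) auto
    then show ?thesis by (simp add: power_mult_distrib mult.commute)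
  qed
  have "(\<Sum>l\<in>F. 1 / (1 + \<bar>\<beta> * real_of_int l - z\<bar>)\<^sup>2)
      \<le> (\<Sum>l\<in>F. (1 / (1 + \<bar>real_of_int (l - r)\<bar>)\<^sup>2) / c\<^sup>2)"
    by (intro sum_mono le)
  also have "\<dots> = (\<Sum>l\<in>(\<lambda>l. l - r) ` F. 1 / (1 + \<bar>real_of_int l\<bar>)\<^sup>2) / c\<^sup>2"
    by (subst sum.reindex) (auto simp: inj_on_def sum_divide_distrib)
  also have "\<dots> \<le> T / c\<^sup>2"
    unfolding T_def using F
    by (intro divide_right_mono finite_sum_le_infsum inverse_square_summable_int) auto
  finally show "(\<Sum>l\<in>F. 1 / (1 + \<bar>\<beta> * real_of_int l - z\<bar>)\<^sup>2) \<le> T / c\<^sup>2 + 1" by simp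
qed

text \<open>A finite set of lattice points lies in a box, and over a box the sum is a product of
  one-dimensional sums.\<close>
lemma sum_inverse_weight_bounded:
  assumes "\<beta> \<noteq> 0"
  obtains S where "0 < S"
    "\<And>z F. finite F \<Longrightarrow> (\<Sum>n\<in>F. 1 / weight (node \<beta> n - z :: real ^ 'd::finite)) \<le> S"
proof -
  obtain S where S: "0 < S"
    "\<And>z F. finite F \<Longrightarrow> (\<Sum>l\<in>F. 1 / (1 + \<bar>\<beta> * real_of_int l - z\<bar>)\<^sup>2) \<le> S"
    using sum_line_bounded[OF assms] by blast
  show thesis
  proof (rule that[of "S ^ CARD('d)"])
    show "0 < S ^ CARD('d)" using S by simp
    fix z :: "real ^ 'd" and F :: "(int ^ 'd) set" assume F: "finite F"
    define h where "h = (\<lambda>k l. 1 / (1 + \<bar>\<beta> * real_of_int l - z $ k\<bar>)\<^sup>2)"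
    define G where "G = (\<lambda>k. (\<lambda>n::int ^ 'd. n $ k) ` F)"
    have "(\<Sum>n\<in>F. 1 / weight (node \<beta> n - z)) = (\<Sum>n\<in>F. \<Prod>k\<in>UNIV. h k (n $ k))"
      by (simp add: weight_def node_def h_def prod_dividef)
    also have "\<dots> = (\<Sum>g\<in>vec_nth ` F. \<Prod>k\<in>UNIV. h k (g k))"
      by (subst sum.reindex) (auto simp: inj_on_def vec_eq_iff)
    also have "\<dots> \<le> (\<Sum>g\<in>PiE UNIV G. \<Prod>k\<in>UNIV. h k (g k))"
      using F by (intro sum_mono2) (auto simp: G_def h_def intro!: finite_PiE prod_nonneg)
    also have "\<dots> = (\<Prod>k\<in>UNIV. \<Sum>l\<in>G k. h k l)"
      using F by (intro prod_sum_PiE[symmetric]) (auto simp: G_def)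
    also have "\<dots> \<le> (\<Prod>k\<in>(UNIV :: 'd set). S)"
      using F S(2) by (intro prod_mono conjI sum_nonneg) (auto simp: G_def h_def)
    also have "\<dots> = S ^ CARD('d)" by simp
    finally show "(\<Sum>n\<in>F. 1 / weight (node \<beta> n - z)) \<le> S ^ CARD('d)" .
  qed
qed

section \<open>The Schur test\<close>

text \<open>Row and column sums are bounded through finite partial sums, so that summability is a
  consequence and not a side condition.\<close>
definition schur :: "('i \<Rightarrow> 'j \<Rightarrow> real) \<Rightarrow> real \<Rightarrow> bool"
  where "schur k S \<longleftrightarrow> 0 < S \<and> (\<forall>i j. 0 \<le> k i j) \<and>
    (\<forall>i J. finite J \<longrightarrow> (\<Sum>j\<in>J. k i j) \<le> S) \<and> (\<forall>j I. finite I \<longrightarrow> (\<Sum>i\<in>I. k i j) \<le> S)"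

lemma schur_pos: "schur k S \<Longrightarrow> 0 < S"
  by (simp add: schur_def)

lemma schur_nonneg: "schur k S \<Longrightarrow> 0 \<le> k i j"
  by (simp add: schur_def)

lemma schur_transpose: "schur k S \<Longrightarrow> schur (\<lambda>i j. k j i) S"
  by (simp add: schur_def)

lemma schur_mult_left: "schur k S \<Longrightarrow> 0 < c \<Longrightarrow> schur (\<lambda>i j. c * k i j) (c * S)"
  by (auto simp: schur_def sum_distrib_left[symmetric])

lemma schur_mono: "schur k S \<Longrightarrow> (\<And>i j. 0 \<le> h i j) \<Longrightarrow> (\<And>i j. h i j \<le> k i j) \<Longrightarrow> schur h S"
  unfolding schur_def by (meson order_trans sum_mono)

lemma schur_row: "schur k S \<Longrightarrow> k i summable_on UNIV" "schur k S \<Longrightarrow> (\<Sum>\<^sub>\<infinity>j. k i j) \<le> S"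
proof -
  assume *: "schur k S"
  show "k i summable_on UNIV"
    using * by (intro nonneg_bdd_above_summable_on bdd_aboveI2[of _ _ S]) (auto simp: schur_def)
  then show "(\<Sum>\<^sub>\<infinity>j. k i j) \<le> S"
    using * by (intro infsum_le_finite_sums) (auto simp: schur_def)
qed

lemma schur_row_bounded_summable:
  assumes "schur k S" "\<And>j. 0 \<le> f j" "\<And>j. f j \<le> (X :: real)"
  shows "(\<lambda>j. k i j * f j) summable_on UNIV"
proof (rule summable_on_comparison_test)
  show "(\<lambda>j. k i j * X) summable_on UNIV"
    using schur_row(1)[OF assms(1)] by (rule summable_on_cmult_left)
qed (use assms schur_nonneg[OF assms(1)] in \<open>auto intro: mult_left_mono\<close>)

lemma powr_above_tangent:
  fixes x z q :: real
  assumes "1 \<le> q" "0 \<le> x" "0 < z"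
  shows "z powr q + q * z powr (q - 1) * (x - z) \<le> x powr q"
proof (cases "x = 0")
  case True
  have "z powr (q - 1) * z = z powr q" using assms by (simp add: powr_mult_base mult.commute)
  then have "z powr q + q * z powr (q - 1) * (x - z) = (1 - q) * z powr q"
    using True by (simp add: algebra_simps)
  also have "\<dots> \<le> 0" using assms by (intro mult_nonpos_nonneg) auto
  finally show ?thesis using True by simp
next
  case False
  have "x powr q - z powr q \<ge> q * z powr (q - 1) * (x - z)"
    using assms False
    by (intro convex_on_imp_above_tangent[OF powr_convex[OF assms(1)]])
       (auto intro!: derivative_eq_intros simp: interior_open powr_diff)
  then show ?thesis by simp
qed

text \<open>Jensen's inequality for the weights \<open>k i j\<close>: the tangent to \<open>t powr q\<close> at the mean \<open>z\<close> is
  integrated against them. The total weight may be smaller than \<open>S\<close>; this only helps, because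
  its coefficient \<open>(1 - q) * z powr q\<close> is not positive.\<close>
lemma schur_jensen:
  fixes f :: "'j \<Rightarrow> real"
  assumes k: "schur k S" and q: "1 \<le> q" and f: "\<And>j. 0 \<le> f j" "\<And>j. f j \<le> X"
  shows "(\<Sum>\<^sub>\<infinity>j. k i j * f j) powr q \<le> S powr (q - 1) * (\<Sum>\<^sub>\<infinity>j. k i j * f j powr q)"
proof (cases "(\<Sum>\<^sub>\<infinity>j. k i j * f j) = 0")
  case True
  then show ?thesis
    using k f schur_pos[OF k] schur_nonneg[OF k]
    by (auto intro!: mult_nonneg_nonneg infsum_nonneg)
next
  case False
  note S = schur_pos[OF k] and knn = schur_nonneg[OF k]
  define a where "a = (\<Sum>\<^sub>\<infinity>j. k i j * f j)"
  define z where "z = a / S"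
  have "0 \<le> a" unfolding a_def using f knn by (intro infsum_nonneg) auto
  then have a: "0 < a" using False by (simp add: a_def)
  then have z: "0 < z" using S by (simp add: z_def)
  have za: "z * S = a" using S by (simp add: z_def)
  have sm0: "k i summable_on UNIV" by (rule schur_row[OF k])
  have sm1: "(\<lambda>j. k i j * f j) summable_on UNIV"
    by (rule schur_row_bounded_summable[OF k f])
  have X: "0 \<le> X" using f[of undefined] by simp
  have smq: "(\<lambda>j. k i j * f j powr q) summable_on UNIV"
    using f q by (intro schur_row_bounded_summable[OF k, of _ "X powr q"]) (auto intro!: powr_mono2)
  have "z powr q * S = (z powr q - q * z powr (q - 1) * z) * S + q * z powr (q - 1) * a"
    using za by (simp add: left_diff_distrib mult.assoc)
  also have "\<dots> \<le> (z powr q - q * z powr (q - 1) * z) * (\<Sum>\<^sub>\<infinity>j. k i j) + q * z powr (q - 1) * a"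
  proof -
    have "z powr (q - 1) * z = z powr q" using z by (simp add: powr_mult_base mult.commute)
    then have "z powr q - q * z powr (q - 1) * z = (1 - q) * z powr q"
      by (simp add: algebra_simps)
    also have "\<dots> \<le> 0" using q by (intro mult_nonpos_nonneg) auto
    finally show ?thesis using schur_row(2)[OF k] by (simp add: mult_left_mono_neg)
  qed
  also have "\<dots> = (\<Sum>\<^sub>\<infinity>j. (z powr q - q * z powr (q - 1) * z) * k i j + q * z powr (q - 1) * (k i j * f j))"
    unfolding a_def using sm0 sm1
    by (subst infsum_add) (auto intro!: summable_on_cmult_right simp: infsum_cmult_right')
  also have "\<dots> \<le> (\<Sum>\<^sub>\<infinity>j. k i j * f j powr q)"
  proof (rule infsum_mono)
    fix j
    have "k i j * (z powr q + q * z powr (q - 1) * (f j - z)) \<le> k i j * f j powr q"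
      using knn by (intro mult_left_mono powr_above_tangent q f z) auto
    then show "(z powr q - q * z powr (q - 1) * z) * k i j + q * z powr (q - 1) * (k i j * f j)
        \<le> k i j * f j powr q"
      by (simp add: algebra_simps)
  qed (use sm0 sm1 smq in \<open>auto intro!: summable_on_add summable_on_cmult_right\<close>)
  finally have *: "z powr q * S \<le> (\<Sum>\<^sub>\<infinity>j. k i j * f j powr q)" .
  have "a powr q = S powr (q - 1) * (z powr q * S)"
    using a S by (simp add: z_def powr_divide powr_diff)
  also have "\<dots> \<le> S powr (q - 1) * (\<Sum>\<^sub>\<infinity>j. k i j * f j powr q)"
    using * by (intro mult_left_mono) auto
  finally show ?thesis by (simp add: a_def)
qed

lemma has_sum_sum:
  fixes f :: "'i \<Rightarrow> 'j \<Rightarrow> 'a::{topological_comm_monoid_add, t2_space}"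
  assumes "finite I" "\<And>i. i \<in> I \<Longrightarrow> (f i has_sum s i) A"
  shows "((\<lambda>j. \<Sum>i\<in>I. f i j) has_sum (\<Sum>i\<in>I. s i)) A"
  using assms by (induction I rule: finite_induct) (auto intro: has_sum_add)

lemma schur_test_powr:
  fixes f :: "'j \<Rightarrow> real"
  assumes k: "schur k S" and q: "1 \<le> q" and f: "\<And>j. 0 \<le> f j" "\<And>j. f j \<le> X"
    and sf: "(\<lambda>j. f j powr q) summable_on UNIV"
    and g: "\<And>i. 0 \<le> g i" "\<And>i. g i \<le> (\<Sum>\<^sub>\<infinity>j. k i j * f j)"
  shows "(\<lambda>i. g i powr q) summable_on UNIV"
    and "(\<Sum>\<^sub>\<infinity>i. g i powr q) \<le> S powr q * (\<Sum>\<^sub>\<infinity>j. f j powr q)"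
proof -
  note S = schur_pos[OF k] and knn = schur_nonneg[OF k]
  have smq: "(\<lambda>j. k i j * f j powr q) summable_on UNIV" for i
    using f q by (intro schur_row_bounded_summable[OF k, of _ "X powr q"]) (auto intro!: powr_mono2)
  have fin: "(\<Sum>i\<in>I. g i powr q) \<le> S powr q * (\<Sum>\<^sub>\<infinity>j. f j powr q)" if I: "finite I" for I
  proof -
    have swap: "((\<lambda>j. \<Sum>i\<in>I. k i j * f j powr q) has_sum (\<Sum>i\<in>I. \<Sum>\<^sub>\<infinity>j. k i j * f j powr q)) UNIV"
      using I smq by (intro has_sum_sum) auto
    have "(\<Sum>i\<in>I. g i powr q) \<le> (\<Sum>i\<in>I. S powr (q - 1) * (\<Sum>\<^sub>\<infinity>j. k i j * f j powr q))"
    proof (rule sum_mono)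
      fix i
      have "g i powr q \<le> (\<Sum>\<^sub>\<infinity>j. k i j * f j) powr q"
        using g q by (intro powr_mono2) auto
      also note schur_jensen[OF k q f]
      finally show "g i powr q \<le> S powr (q - 1) * (\<Sum>\<^sub>\<infinity>j. k i j * f j powr q)" .
    qed
    also have "\<dots> = S powr (q - 1) * (\<Sum>\<^sub>\<infinity>j. \<Sum>i\<in>I. k i j * f j powr q)"
      using infsumI[OF swap] by (simp add: sum_distrib_left)
    also have "\<dots> \<le> S powr (q - 1) * (\<Sum>\<^sub>\<infinity>j. S * f j powr q)"
    proof (intro mult_left_mono infsum_mono)
      show "(\<Sum>i\<in>I. k i j * f j powr q) \<le> S * f j powr q" for j
        using k I unfolding sum_distrib_right[symmetric] schur_def
        by (intro mult_right_mono) auto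
      show "(\<lambda>j. \<Sum>i\<in>I. k i j * f j powr q) summable_on UNIV"
        using swap by (rule has_sum_imp_summable)
    qed (auto intro!: summable_on_cmult_right sf)
    also have "\<dots> = S powr q * (\<Sum>\<^sub>\<infinity>j. f j powr q)"
      using S by (simp add: infsum_cmult_right' powr_diff)
    finally show ?thesis .
  qed
  show "(\<lambda>i. g i powr q) summable_on UNIV"
    using fin by (intro nonneg_bdd_above_summable_on) (auto simp: bdd_above_def)
  then show "(\<Sum>\<^sub>\<infinity>i. g i powr q) \<le> S powr q * (\<Sum>\<^sub>\<infinity>j. f j powr q)"
    using fin by (rule infsum_le_finite_sums)
qed

text \<open>Rows sit at the points \<open>\<alpha> m\<close> and columns at the points \<open>\<beta> n\<close>. Since the lattice sums are
  bounded uniformly in the center, both the rows and the columns of the kernel are controlled.\<close>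
lemma schur_inverse_weight:
  assumes "\<alpha> \<noteq> 0" "\<beta> \<noteq> 0"
  shows "\<exists>S. schur (\<lambda>m n. 1 / weight (node \<alpha> m - node \<beta> n :: real ^ 'd::finite)) S"
proof -
  obtain S where S: "0 < S"
    "\<And>z F. finite F \<Longrightarrow> (\<Sum>n\<in>F. 1 / weight (node \<alpha> n - z :: real ^ 'd)) \<le> S"
    using sum_inverse_weight_bounded[OF assms(1)] by metis
  obtain T where T: "0 < T"
    "\<And>z F. finite F \<Longrightarrow> (\<Sum>n\<in>F. 1 / weight (node \<beta> n - z :: real ^ 'd)) \<le> T"
    using sum_inverse_weight_bounded[OF assms(2)] by metis
  have "schur (\<lambda>m n. 1 / weight (node \<alpha> m - node \<beta> n :: real ^ 'd)) (S + T)"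
    unfolding schur_def
  proof (intro conjI allI impI)
    fix m and J :: "(int ^ 'd) set" assume "finite J"
    then show "(\<Sum>n\<in>J. 1 / weight (node \<alpha> m - node \<beta> n :: real ^ 'd)) \<le> S + T"
      using T(2)[of J "node \<alpha> m"] S(1) by (simp add: weight_diff_commute[of "node \<alpha> m"])
  next
    fix n and I :: "(int ^ 'd) set" assume "finite I"
    then show "(\<Sum>m\<in>I. 1 / weight (node \<alpha> m - node \<beta> n :: real ^ 'd)) \<le> S + T"
      using S(2)[of I "node \<beta> n"] T(1) by simp
  qed (use S T less_imp_le[OF weight_pos] in auto)
  then show ?thesis by blast
qed

section \<open>Sequence spaces of arbitrary exponent\<close>

lemma ereal_exponent_cases:
  assumes "1 \<le> (p :: ereal)"
  obtains "p = \<infinity>" | r where "p = ereal r" "1 \<le> r"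
  using assms by (cases p) auto

lemma lp_infty: "lp \<infinity> = {x. bounded (range x)}" "lp_norm \<infinity> x = (SUP n. norm (x n))"
  by (simp_all add: lp_def lp_norm_def)

lemma lp_real:
  "lp (ereal r) = {x. (\<lambda>n. norm (x n) powr r) summable_on UNIV}"
  "lp_norm (ereal r) x = (\<Sum>\<^sub>\<infinity>n. norm (x n) powr r) powr (1 / r)"
  by (simp_all add: lp_def lp_norm_def)

lemma lp_norm_nonneg: "0 \<le> lp_norm p x" if "x \<in> lp p"
proof (cases "p = \<infinity>")
  case True
  then have "bdd_above (range (\<lambda>n. norm (x n)))"
    using that by (auto simp: lp_def bounded_iff bdd_above_def)
  then show ?thesis
    using True norm_ge_zero[of "x undefined"] unfolding lp_norm_def
    by (auto intro: order_trans[OF norm_ge_zero] cSUP_upper2)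
qed (simp add: lp_norm_def)

lemma norm_le_lp_norm:
  assumes "1 \<le> p" "x \<in> lp p"
  shows "norm (x n) \<le> lp_norm p x"
  using assms(1)
proof (cases rule: ereal_exponent_cases)
  case 1
  then have "bdd_above (range (\<lambda>n. norm (x n)))"
    using assms by (auto simp: lp_def bounded_iff bdd_above_def)
  then show ?thesis using 1 by (auto simp: lp_norm_def intro: cSUP_upper)
next
  case (2 r)
  then have "norm (x n) powr r \<le> (\<Sum>\<^sub>\<infinity>n. norm (x n) powr r)"
    using assms(2) finite_sum_le_infsum[of "\<lambda>n. norm (x n) powr r" UNIV "{n}"] by (simp add: lp_real)
  then have "(norm (x n) powr r) powr (1 / r) \<le> lp_norm p x"
    using 2 by (auto simp: lp_real intro!: powr_mono2)
  then show ?thesis using 2 by (simp add: powr_powr)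
qed

lemma lp_schur_test:
  fixes x :: "int ^ 'd::finite \<Rightarrow> 'a::complex_hilbert" and y :: "int ^ 'd \<Rightarrow> 'b::complex_hilbert"
  assumes p: "1 \<le> p" and x: "x \<in> lp p" and k: "schur k S"
    and y: "\<And>m. norm (y m) \<le> (\<Sum>\<^sub>\<infinity>n. k m n * norm (x n))"
  shows "y \<in> lp p" and "lp_norm p y \<le> S * lp_norm p x"
proof -
  note bd = norm_le_lp_norm[OF p x]
  note S = schur_pos[OF k]
  have "y \<in> lp p \<and> lp_norm p y \<le> S * lp_norm p x"
    using p
  proof (cases rule: ereal_exponent_cases)
    case 1
    have "norm (y m) \<le> S * lp_norm p x" for m
    proof -
      have "norm (y m) \<le> (\<Sum>\<^sub>\<infinity>n. k m n * norm (x n))" by (rule y)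
      also have "\<dots> \<le> (\<Sum>\<^sub>\<infinity>n. k m n * lp_norm p x)"
        by (intro infsum_mono mult_left_mono bd schur_nonneg[OF k] schur_row_bounded_summable[OF k _ bd]
            summable_on_cmult_left schur_row[OF k]) auto
      also have "\<dots> = (\<Sum>\<^sub>\<infinity>n. k m n) * lp_norm p x" by (simp add: infsum_cmult_left')
      also have "\<dots> \<le> S * lp_norm p x"
        by (intro mult_right_mono schur_row[OF k] lp_norm_nonneg x)
      finally show ?thesis .
    qed
    then show ?thesis
      using 1 by (auto simp: lp_infty bounded_iff intro!: cSUP_least)
  next
    case (2 r)
    have sx: "(\<lambda>n. norm (x n) powr r) summable_on UNIV" using x 2 by (simp add: lp_real)
    note t = schur_test_powr[OF k 2(2) norm_ge_zero bd sx norm_ge_zero y]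
    have "lp_norm p y \<le> (S powr r * (\<Sum>\<^sub>\<infinity>n. norm (x n) powr r)) powr (1 / r)"
      using 2 t(2) by (auto simp: lp_real intro!: powr_mono2 infsum_nonneg)
    also have "\<dots> = S * lp_norm p x"
      using 2 S by (simp add: lp_real powr_mult powr_powr infsum_nonneg)
    finally show ?thesis using 2 t(1) by (simp add: lp_real)
  qed
  then show "y \<in> lp p" "lp_norm p y \<le> S * lp_norm p x" by auto
qed

lemma lp_of_summable:
  fixes x :: "int ^ 'd::finite \<Rightarrow> 'a::complex_hilbert"
  assumes p: "1 \<le> p" and sx: "(\<lambda>n. norm (x n)) summable_on UNIV"
  shows "x \<in> lp p" and "lp_norm p x \<le> (\<Sum>\<^sub>\<infinity>n. norm (x n))"
proof -
  define a where "a = (\<Sum>\<^sub>\<infinity>n. norm (x n))"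
  have a: "0 \<le> a" unfolding a_def by (intro infsum_nonneg) auto
  have bd: "norm (x n) \<le> a" for n
    using finite_sum_le_infsum[OF sx, of "{n}"] by (simp add: a_def)
  have "x \<in> lp p \<and> lp_norm p x \<le> a"
    using p
  proof (cases rule: ereal_exponent_cases)
    case 1
    then show ?thesis using bd by (auto simp: lp_infty bounded_iff intro!: cSUP_least)
  next
    case (2 r)
    have le: "norm (x n) powr r \<le> a powr (r - 1) * norm (x n)" for n
    proof -
      have "norm (x n) powr r = norm (x n) powr (r - 1) * norm (x n)"
        by (cases "x n = 0") (simp_all add: powr_diff)
      also have "\<dots> \<le> a powr (r - 1) * norm (x n)"
        using 2 bd by (intro mult_right_mono powr_mono2) auto
      finally show ?thesis .
    qed
    have s: "(\<lambda>n. norm (x n) powr r) summable_on UNIV"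
      by (rule summable_on_comparison_test[OF summable_on_cmult_right[OF sx] le]) auto
    have "(\<Sum>\<^sub>\<infinity>n. norm (x n) powr r) \<le> (\<Sum>\<^sub>\<infinity>n. a powr (r - 1) * norm (x n))"
      by (intro infsum_mono s le summable_on_cmult_right sx)
    also have "\<dots> = a powr (r - 1) * a" by (simp add: infsum_cmult_right' a_def)
    also have "\<dots> = a powr r" using a by (cases "a = 0") (simp_all add: powr_diff)
    finally have "lp_norm p x \<le> (a powr r) powr (1 / r)"
      using 2 by (auto simp: lp_real intro!: powr_mono2 infsum_nonneg)
    then show ?thesis using 2 s a by (simp add: lp_real powr_powr)
  qed
  then show "x \<in> lp p" "lp_norm p x \<le> (\<Sum>\<^sub>\<infinity>n. norm (x n))" by (auto simp: a_def)
qed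

text \<open>The summands may take values in different spaces and only the norms matter. A fixed
  constant such as 4 is harmless below, where one of the two terms can be made as small as desired.\<close>
lemma lp_norm_quasi_triangle:
  fixes x :: "int ^ 'd::finite \<Rightarrow> 'a::complex_hilbert"
    and y :: "int ^ 'd \<Rightarrow> 'b::complex_hilbert" and z :: "int ^ 'd \<Rightarrow> 'c::complex_hilbert"
  assumes p: "1 \<le> p" and y: "y \<in> lp p" and z: "z \<in> lp p"
    and x: "\<And>n. norm (x n) \<le> norm (y n) + norm (z n)"
  shows "lp_norm p x \<le> 4 * (lp_norm p y + lp_norm p z)"
  using p
proof (cases rule: ereal_exponent_cases)
  case 1
  have "norm (x n) \<le> lp_norm p y + lp_norm p z" for n
    using x[of n] norm_le_lp_norm[OF p y, of n] norm_le_lp_norm[OF p z, of n] by linarith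
  then have "lp_norm p x \<le> lp_norm p y + lp_norm p z"
    using 1 by (simp add: lp_infty cSUP_least)
  moreover have "0 \<le> lp_norm p y" "0 \<le> lp_norm p z"
    using y z by (auto intro: lp_norm_nonneg)
  ultimately show ?thesis by (simp add: distrib_left)
next
  case (2 r)
  define Y where "Y = (\<Sum>\<^sub>\<infinity>n. norm (y n) powr r)"
  define Z where "Z = (\<Sum>\<^sub>\<infinity>n. norm (z n) powr r)"
  have nn: "0 \<le> Y" "0 \<le> Z" unfolding Y_def Z_def by (auto intro!: infsum_nonneg)
  have le: "norm (x n) powr r \<le> 2 powr r * (norm (y n) powr r + norm (z n) powr r)" for n
  proof -
    have "norm (x n) powr r \<le> (2 * max (norm (y n)) (norm (z n))) powr r"
      using x[of n] 2 by (intro powr_mono2) auto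
    also have "\<dots> = 2 powr r * max (norm (y n)) (norm (z n)) powr r"
      by (simp add: powr_mult)
    also have "\<dots> \<le> 2 powr r * (norm (y n) powr r + norm (z n) powr r)"
      by (intro mult_left_mono) (auto simp: max_def)
    finally show ?thesis .
  qed
  have sy: "(\<lambda>n. norm (y n) powr r) summable_on UNIV" and sz: "(\<lambda>n. norm (z n) powr r) summable_on UNIV"
    using y z 2 by (simp_all add: lp_real)
  then have sr: "(\<lambda>n. 2 powr r * (norm (y n) powr r + norm (z n) powr r)) summable_on UNIV"
    by (intro summable_on_cmult_right summable_on_add)
  have sx: "(\<lambda>n. norm (x n) powr r) summable_on UNIV"
    by (rule summable_on_comparison_test[OF sr le]) auto
  have "(\<Sum>\<^sub>\<infinity>n. norm (x n) powr r) \<le> (\<Sum>\<^sub>\<infinity>n. 2 powr r * (norm (y n) powr r + norm (z n) powr r))"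
    by (intro infsum_mono sx sr le)
  also have "\<dots> = 2 powr r * (Y + Z)"
    by (simp add: infsum_cmult_right' infsum_add[OF sy sz] Y_def Z_def)
  also have "\<dots> \<le> 2 powr r * (2 powr r * max Y Z)"
    using 2 powr_mono[of 1 r 2] nn
    by (intro mult_left_mono order_trans[OF _ mult_right_mono[of 2 "2 powr r" "max Y Z"]]) auto
  finally have "lp_norm p x \<le> (2 powr r * (2 powr r * max Y Z)) powr (1 / r)"
    using 2 by (auto simp: lp_real intro!: powr_mono2 infsum_nonneg)
  also have "\<dots> = 4 * max Y Z powr (1 / r)"
    using 2 nn by (simp add: powr_mult powr_powr)
  also have "\<dots> \<le> 4 * (lp_norm p y + lp_norm p z)"
    using 2 by (auto simp: lp_real Y_def Z_def max_def)
  finally show ?thesis .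
qed

section \<open>Complex scalars and infinite sums\<close>

lemma scaleC_scaleR: "c *\<^sub>C (r *\<^sub>R x) = r *\<^sub>R (c *\<^sub>C (x :: 'a::complex_vector))"
  by (simp add: scaleC_of_real[symmetric] scaleC_scaleC mult.commute)

lemma inner_scaleC_left: "inner (c *\<^sub>C x) y = inner x (cnj c *\<^sub>C (y :: 'a::complex_inner))"
proof -
  have "cinner x (cnj c *\<^sub>C y) = cnj (cinner (cnj c *\<^sub>C y) x)" by (rule cinner_commute)
  also have "\<dots> = c * cnj (cinner y x)" by (simp add: cinner_scaleC_left)
  also have "cnj (cinner y x) = cinner x y" by (rule cinner_commute[symmetric])
  also have "c * cinner x y = cinner (c *\<^sub>C x) y" by (simp add: cinner_scaleC_left)
  finally show ?thesis by (metis Re_cinner)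
qed

lemma norm_scaleC: "norm (c *\<^sub>C x) = cmod c * norm (x :: 'a::complex_inner)"
proof -
  have "(norm (c *\<^sub>C x))\<^sup>2 = inner x ((cnj c * c) *\<^sub>C x)"
    unfolding power2_norm_eq_inner inner_scaleC_left scaleC_scaleC ..
  also have "cnj c * c = complex_of_real ((cmod c)\<^sup>2)"
    by (metis complex_norm_square mult.commute)
  also have "inner x (complex_of_real ((cmod c)\<^sup>2) *\<^sub>C x) = (cmod c * norm x)\<^sup>2"
    unfolding scaleC_of_real by (simp add: power2_norm_eq_inner power_mult_distrib)
  finally show ?thesis by (rule power2_eq_imp_eq) auto
qed

lemma bounded_linear_scaleC: "bounded_linear (\<lambda>x :: 'a::complex_inner. c *\<^sub>C x)"
  by (rule bounded_linear_intro[where K = "cmod c"])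
     (auto simp: scaleC_add_right scaleC_scaleR norm_scaleC)

lemma infsum_image_bounded_linear:
  assumes "bounded_linear h" "f summable_on A"
  shows "(\<Sum>\<^sub>\<infinity>x\<in>A. h (f x)) = h (\<Sum>\<^sub>\<infinity>x\<in>A. f x)"
  using has_sum_bounded_linear[OF assms(1) has_sum_infsum[OF assms(2)]]
  unfolding o_def by (rule infsumI)

lemma bounded_clinear_linear: "bounded_clinear f \<Longrightarrow> bounded_linear f"
  by (simp add: bounded_clinear_def)

lemma bounded_clinear_scaleC: "bounded_clinear f \<Longrightarrow> f (c *\<^sub>C x) = c *\<^sub>C f x"
  by (simp add: bounded_clinear_def)

lemma bounded_clinear_scaleR_const: "bounded_clinear f \<Longrightarrow> bounded_clinear (\<lambda>x. r *\<^sub>R f x)"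
  by (simp add: bounded_clinear_def bounded_linear_scaleR_right bounded_linear_const_scaleR scaleC_scaleR)

section \<open>Operator matrices with a Schur kernel\<close>

definition dominated ::
    "('d::finite, 'x::complex_hilbert, 'y::complex_hilbert) op_matrix \<Rightarrow> (int ^ 'd \<Rightarrow> int ^ 'd \<Rightarrow> real) \<Rightarrow> bool"
  where "dominated A k \<longleftrightarrow>
    (\<forall>m n. bounded_clinear (A m n)) \<and> (\<forall>m n v. norm (A m n v) \<le> k m n * norm v)"

lemma dominated_clinear: "dominated A k \<Longrightarrow> bounded_clinear (A m n)"
  by (simp add: dominated_def)

lemma dominated_linear: "dominated A k \<Longrightarrow> bounded_linear (A m n)"
  by (simp add: dominated_def bounded_clinear_def)

lemma dominated_le: "dominated A k \<Longrightarrow> norm (A m n v) \<le> k m n * norm v"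
  by (simp add: dominated_def)

lemma mat_apply_summable:
  assumes A: "dominated A k" and k: "schur k S" and x: "\<And>n. norm (x n) \<le> X"
  shows "(\<lambda>n. norm (A m n (x n))) summable_on UNIV"
    and "(\<lambda>n. A m n (x n)) summable_on UNIV"
    and "norm (mat_apply A x m) \<le> (\<Sum>\<^sub>\<infinity>n. k m n * norm (x n))"
proof -
  have sk: "(\<lambda>n. k m n * norm (x n)) summable_on UNIV"
    by (rule schur_row_bounded_summable[OF k norm_ge_zero x])
  show 1: "(\<lambda>n. norm (A m n (x n))) summable_on UNIV"
    by (rule summable_on_comparison_test[OF sk dominated_le[OF A]]) auto
  then show "(\<lambda>n. A m n (x n)) summable_on UNIV"
    by (rule abs_summable_summable)
  have "norm (mat_apply A x m) \<le> (\<Sum>\<^sub>\<infinity>n. norm (A m n (x n)))"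
    unfolding mat_apply_def using 1 by (rule norm_infsum_bound)
  also have "\<dots> \<le> (\<Sum>\<^sub>\<infinity>n. k m n * norm (x n))"
    by (rule infsum_mono[OF 1 sk dominated_le[OF A]])
  finally show "norm (mat_apply A x m) \<le> (\<Sum>\<^sub>\<infinity>n. k m n * norm (x n))" .
qed

lemma mat_apply_add:
  assumes A: "dominated A k" and k: "schur k S"
    and x: "\<And>n. norm (x n) \<le> X" and y: "\<And>n. norm (y n) \<le> Y"
  shows "mat_apply A (\<lambda>n. x n + y n) m = mat_apply A x m + mat_apply A y m"
  unfolding mat_apply_def linear_add[OF bounded_linear.linear[OF dominated_linear[OF A]]]
  by (intro infsum_add mat_apply_summable(2)[OF A k x] mat_apply_summable(2)[OF A k y])

lemma mat_apply_scaleC: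
  assumes A: "dominated A k" and k: "schur k S" and x: "\<And>n. norm (x n) \<le> X"
  shows "mat_apply A (\<lambda>n. c *\<^sub>C x n) m = c *\<^sub>C mat_apply A x m"
  unfolding mat_apply_def bounded_clinear_scaleC[OF dominated_clinear[OF A]]
  by (rule infsum_image_bounded_linear[OF bounded_linear_scaleC mat_apply_summable(2)[OF A k x]])

lemma mat_apply_lp:
  assumes p: "1 \<le> p" and x: "x \<in> lp p" and A: "dominated A k" and k: "schur k S"
  shows "mat_apply A x \<in> lp p" and "lp_norm p (mat_apply A x) \<le> S * lp_norm p x"
  using lp_schur_test[OF p x k mat_apply_summable(3)[OF A k norm_le_lp_norm[OF p x]]] by auto

lemma mat_apply_bounded:
  assumes A: "dominated A k" and k: "schur k S" and x: "\<And>n. norm (x n) \<le> X"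
  shows "norm (mat_apply A x m) \<le> S * lp_norm \<infinity> x"
proof -
  have "x \<in> lp \<infinity>" using x by (auto simp: lp_infty bounded_iff)
  note * = mat_apply_lp[OF _ this A k]
  have "norm (mat_apply A x m) \<le> lp_norm \<infinity> (mat_apply A x)"
    by (rule norm_le_lp_norm[OF _ *(1)]) auto
  also have "\<dots> \<le> S * lp_norm \<infinity> x" by (rule *(2)) simp
  finally show ?thesis .
qed

lemma mat_apply_mat_apply:
  assumes B: "dominated B h" and h: "schur h T" and A: "dominated A k" and k: "schur k S"
    and x: "\<And>n. norm (x n) \<le> X"
  shows "mat_apply B (mat_apply A x) i = (\<Sum>\<^sub>\<infinity>n. \<Sum>\<^sub>\<infinity>m. B i m (A m n (x n)))"
proof -
  have X: "0 \<le> X" using x[of undefined] norm_ge_zero order_trans by blast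
  have le: "norm (B i m (A m n (x n))) \<le> h i m * (k m n * X)" for m n
  proof -
    have "norm (B i m (A m n (x n))) \<le> h i m * norm (A m n (x n))"
      by (rule dominated_le[OF B])
    also have "\<dots> \<le> h i m * (k m n * norm (x n))"
      by (intro mult_left_mono dominated_le[OF A] schur_nonneg[OF h])
    also have "\<dots> \<le> h i m * (k m n * X)"
      by (intro mult_left_mono x schur_nonneg[OF h] schur_nonneg[OF k])
    finally show ?thesis .
  qed
  have row: "((\<lambda>n. h i m * (k m n * X)) has_sum h i m * ((\<Sum>\<^sub>\<infinity>n. k m n) * X)) UNIV" for m
    by (intro has_sum_cmult_right has_sum_cmult_left has_sum_infsum schur_row[OF k])
  have "(\<lambda>m. h i m * ((\<Sum>\<^sub>\<infinity>n. k m n) * X)) summable_on UNIV"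
  proof (rule schur_row_bounded_summable[OF h])
    show "0 \<le> (\<Sum>\<^sub>\<infinity>n. k m n) * X" for m
      by (intro mult_nonneg_nonneg infsum_nonneg schur_nonneg[OF k] X)
    show "(\<Sum>\<^sub>\<infinity>n. k m n) * X \<le> S * X" for m
      by (intro mult_right_mono schur_row[OF k] X)
  qed
  then have "(\<lambda>(m, n). h i m * (k m n * X)) summable_on UNIV \<times> UNIV"
    by (rule summable_on_SigmaI[rotated])
       (use row X schur_nonneg[OF h] schur_nonneg[OF k] in auto)
  then have "(\<lambda>(m, n). norm (B i m (A m n (x n)))) summable_on UNIV \<times> UNIV"
    by (rule summable_on_comparison_test) (use le in auto)
  then have sm: "(\<lambda>(m, n). B i m (A m n (x n))) summable_on UNIV \<times> UNIV"
    using abs_summable_summable[of "\<lambda>(m, n). B i m (A m n (x n))"] by (simp add: case_prod_beta')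
  have "mat_apply B (mat_apply A x) i = (\<Sum>\<^sub>\<infinity>m. \<Sum>\<^sub>\<infinity>n. B i m (A m n (x n)))"
    unfolding mat_apply_def
    by (intro infsum_cong infsum_image_bounded_linear[symmetric] dominated_linear[OF B]
        mat_apply_summable(2)[OF A k x])
  also have "\<dots> = (\<Sum>\<^sub>\<infinity>n. \<Sum>\<^sub>\<infinity>m. B i m (A m n (x n)))"
    by (rule infsum_swap_banach[OF sm])
  finally show ?thesis .
qed

section \<open>Slowly varying cutoffs\<close>

text \<open>By submultiplicativity the ratio lies between \<open>1 / w\<close> and \<open>w\<close> with \<open>w = weight (\<epsilon> *\<^sub>R (a - b))\<close>,
  and \<open>w - 1\<close> is at most \<open>\<epsilon> * weight (a - b)\<close>.\<close>
lemma weight_ratio: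
  fixes a b z :: "real ^ 'd::finite"
  assumes "0 < \<epsilon>" "\<epsilon> \<le> 1"
  shows "\<bar>1 - weight (\<epsilon> *\<^sub>R (b - z)) / weight (\<epsilon> *\<^sub>R (a - z))\<bar> \<le> \<epsilon> * weight (a - b)"
proof -
  define P where "P = weight (\<epsilon> *\<^sub>R (b - z))"
  define Q where "Q = weight (\<epsilon> *\<^sub>R (a - z))"
  define w where "w = weight (\<epsilon> *\<^sub>R (a - b))"
  have pos: "0 < P" "0 < Q" "1 \<le> w" by (simp_all add: P_def Q_def w_def weight_pos weight_ge_1)
  have "P \<le> w * Q"
    using weight_add_le[of "\<epsilon> *\<^sub>R (b - a)" "\<epsilon> *\<^sub>R (a - z)"] weight_minus[of "\<epsilon> *\<^sub>R (a - b)"]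
    by (simp add: P_def Q_def w_def scaleR_diff_right)
  then have 1: "P / Q \<le> w" using pos by (simp add: divide_le_eq)
  have "Q \<le> w * P"
    using weight_add_le[of "\<epsilon> *\<^sub>R (a - b)" "\<epsilon> *\<^sub>R (b - z)"]
    by (simp add: P_def Q_def w_def scaleR_diff_right)
  then have 2: "1 / w \<le> P / Q" using pos by (simp add: field_simps)
  have "2 \<le> w + 1 / w"
    using zero_le_power2[of "w - 1"] pos by (simp add: field_simps power2_eq_square)
  with 1 2 have "\<bar>1 - P / Q\<bar> \<le> w - 1" by (simp add: abs_le_iff)
  also have "\<dots> \<le> \<epsilon> * (weight (a - b) - 1)"
    unfolding w_def using assms by (intro weight_scaled_le) auto
  also have "\<dots> \<le> \<epsilon> * weight (a - b)" using assms by simp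
  finally show ?thesis by (simp add: P_def Q_def)
qed

definition cutoff :: "real \<Rightarrow> real ^ 'd \<Rightarrow> real ^ 'd \<Rightarrow> real"
  where "cutoff \<epsilon> z a = 1 / weight (\<epsilon> *\<^sub>R (a - z))"

lemma cutoff_pos: "0 < cutoff \<epsilon> z (a :: real ^ 'd::finite)"
  by (simp add: cutoff_def weight_pos)

lemma cutoff_le_1: "cutoff \<epsilon> z (a :: real ^ 'd::finite) \<le> 1"
  using weight_ge_1[of "\<epsilon> *\<^sub>R (a - z)"] by (simp add: cutoff_def)

lemma cutoff_self [simp]: "cutoff \<epsilon> z (z :: real ^ 'd::finite) = 1"
  by (simp add: cutoff_def)

lemma cutoff_le:
  fixes a z :: "real ^ 'd::finite"
  assumes "0 < \<epsilon>" "\<epsilon> \<le> 1"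
  shows "cutoff \<epsilon> z a \<le> (1 / \<epsilon> ^ (2 * CARD('d))) * (1 / weight (a - z))"
proof -
  have "0 < \<epsilon> ^ (2 * CARD('d)) * weight (a - z)" using assms by (simp add: weight_pos)
  then have "cutoff \<epsilon> z a \<le> 1 / (\<epsilon> ^ (2 * CARD('d)) * weight (a - z))"
    unfolding cutoff_def using weight_scaled_ge[OF assms, of "a - z"]
    by (intro divide_left_mono) (auto simp: weight_pos intro: mult_pos_pos)
  then show ?thesis by simp
qed

lemma cutoff_ratio:
  assumes "0 < \<epsilon>" "\<epsilon> \<le> 1"
  shows "\<bar>1 - cutoff \<epsilon> z a / cutoff \<epsilon> z (b :: real ^ 'd::finite)\<bar> \<le> \<epsilon> * weight (a - b)"
  using weight_ratio[OF assms, of b z a] by (simp add: cutoff_def)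

definition slanted_decay :: "real \<Rightarrow> real \<Rightarrow> int ^ 'd \<Rightarrow> int ^ 'd \<Rightarrow> real"
  where "slanted_decay \<alpha> C m n = C / weight (node \<alpha> m - node 1 n)"

text \<open>The matrix decays like the square of the weight because one factor is spent on the
  oscillation of the cutoffs and the other one is left for the Schur test.\<close>
definition strong_decay :: "real \<Rightarrow> real \<Rightarrow> int ^ 'd \<Rightarrow> int ^ 'd \<Rightarrow> real"
  where "strong_decay \<alpha> C m n = C / (weight (node \<alpha> m - node 1 n))\<^sup>2"

text \<open>The difference between \<open>A\<close> and its entrywise product with \<open>c\<close>. For \<open>c m n = r m / s n\<close> that
  product is \<open>A\<close> conjugated by the multiplication operators \<open>r\<close> and \<open>s\<close>.\<close>
definition entry_defect ::
    "(int ^ 'd \<Rightarrow> int ^ 'd \<Rightarrow> real) \<Rightarrow> ('d::finite, 'x::complex_hilbert, 'y::complex_hilbert) op_matrix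
      \<Rightarrow> ('d, 'x, 'y) op_matrix"
  where "entry_defect c A m n v = (1 - c m n) *\<^sub>R A m n v"

lemma dominated_entry_defect:
  assumes A: "dominated A (strong_decay \<alpha> C)" and C: "0 < C"
    and c: "\<And>m n. \<bar>1 - c m n\<bar> \<le> \<epsilon> * weight (node \<alpha> m - node 1 n)"
  shows "dominated (entry_defect c A) (slanted_decay \<alpha> (\<epsilon> * C))"
  unfolding dominated_def
proof (intro conjI allI)
  fix m n v
  show "bounded_clinear (entry_defect c A m n)"
    unfolding entry_defect_def[abs_def] by (intro bounded_clinear_scaleR_const dominated_clinear[OF A])
  define w where "w = weight (node \<alpha> m - node 1 n :: real ^ 'a)"
  have w: "0 < w" by (simp add: w_def weight_pos)
  have "norm (entry_defect c A m n v) \<le> (\<epsilon> * w) * (C / w\<^sup>2 * norm v)"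
    using c[of m n] dominated_le[OF A, of m n v] C
    unfolding entry_defect_def norm_scaleR w_def strong_decay_def
    by (intro mult_mono) (auto intro: order_trans[OF abs_ge_zero])
  also have "\<dots> = slanted_decay \<alpha> (\<epsilon> * C) m n * norm v"
    using w by (simp add: slanted_decay_def w_def[symmetric] power2_eq_square)
  finally show "norm (entry_defect c A m n v) \<le> slanted_decay \<alpha> (\<epsilon> * C) m n * norm v" .
qed

lemma schur_decay:
  assumes "\<alpha> \<noteq> 0"
  obtains S where "\<And>C. 0 < C \<Longrightarrow> schur (slanted_decay \<alpha> C :: int ^ 'd::finite \<Rightarrow> int ^ 'd \<Rightarrow> real) (C * S)"
    "\<And>C. 0 < C \<Longrightarrow> schur (strong_decay \<alpha> C :: int ^ 'd \<Rightarrow> int ^ 'd \<Rightarrow> real) (C * S)" "0 < S"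
proof -
  obtain S where S: "schur (\<lambda>m n. 1 / weight (node \<alpha> m - node 1 n :: real ^ 'd)) S"
    using schur_inverse_weight[OF assms, of 1] by auto
  have 1: "schur (slanted_decay \<alpha> C :: int ^ 'd \<Rightarrow> int ^ 'd \<Rightarrow> real) (C * S)" if "0 < C" for C
    using schur_mult_left[OF S that] by (simp add: slanted_decay_def[abs_def])
  show thesis
  proof (rule that[OF 1])
    show "schur (strong_decay \<alpha> C :: int ^ 'd \<Rightarrow> int ^ 'd \<Rightarrow> real) (C * S)" if C: "0 < C" for C
    proof (rule schur_mono[OF 1[OF C]])
      fix m n :: "int ^ 'd"
      show "0 \<le> strong_decay \<alpha> C m n" using C by (simp add: strong_decay_def)
      have w: "1 \<le> weight (node \<alpha> m - node 1 n :: real ^ 'd)" by (rule weight_ge_1)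
      then show "strong_decay \<alpha> C m n \<le> slanted_decay \<alpha> C m n"
        unfolding strong_decay_def slanted_decay_def using C self_le_power[OF w, of 2]
        by (intro divide_left_mono) auto
    qed
    show "0 < S" by (rule schur_pos[OF S])
  qed
qed

text \<open>Stated for a single row \<open>m\<close>, which covers both conjugations: \<open>y = s x\<close> with \<open>a = r m\<close> and
  \<open>c m n = r m / s n\<close>, and \<open>x = s y\<close> with \<open>a = 1 / r m\<close> and \<open>c m n = s n / r m\<close>.\<close>
lemma mat_apply_entry_defect:
  assumes A: "dominated A k" and k: "schur k S" and E: "dominated (entry_defect c A) h" and h: "schur h T"
    and y: "\<And>n. norm (y n) \<le> Y" and c: "\<And>n. c m n *\<^sub>R y n = a *\<^sub>R x n"
  shows "mat_apply A y m - mat_apply (entry_defect c A) y m = a *\<^sub>R mat_apply A x m"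
proof -
  note cmul = linear_cmul[OF bounded_linear.linear[OF dominated_linear[OF A]]]
  have "a *\<^sub>R mat_apply A x m = (\<Sum>\<^sub>\<infinity>n. a *\<^sub>R A m n (x n))"
    unfolding mat_apply_def by (rule infsum_scaleR_right[symmetric])
  also have "\<dots> = (\<Sum>\<^sub>\<infinity>n. A m n (y n) + (- entry_defect c A m n (y n)))"
  proof (rule infsum_cong)
    fix n
    have "a *\<^sub>R A m n (x n) = c m n *\<^sub>R A m n (y n)"
      by (metis c cmul)
    then show "a *\<^sub>R A m n (x n) = A m n (y n) + (- entry_defect c A m n (y n))"
      by (simp add: entry_defect_def scaleR_diff_left)
  qed
  also have "\<dots> = mat_apply A y m - mat_apply (entry_defect c A) y m"
    unfolding mat_apply_def
    by (subst infsum_add)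
       (auto intro!: mat_apply_summable(2)[OF A k y] mat_apply_summable(2)[OF E h y]
         simp: infsum_uminus summable_on_uminus)
  finally show ?thesis by simp
qed

section \<open>Stability of lower bounds in the exponent\<close>

text \<open>The lower bound of \<open>A\<close> is applied to \<open>x\<close> localised around the lattice point \<open>i\<close>. The cutoff
  is summable, so the localised sequence lies in \<open>l^p\<close> for every bounded \<open>x\<close>, whatever exponent \<open>x\<close>
  comes from; and since \<open>\<epsilon>\<close> does not depend on \<open>i\<close>, neither does the constant.\<close>
lemma stability_pointwise:
  fixes A :: "('d::finite, 'x::complex_hilbert, 'y::complex_hilbert) op_matrix"
  assumes \<alpha>: "\<alpha> \<noteq> 0" and A: "dominated A (strong_decay \<alpha> C)" and C: "0 < C"
    and p: "1 \<le> p" and below: "bounded_below_lp p A"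
  obtains D where "0 < D"
    "\<And>x X i. (\<And>n. norm (x n) \<le> X) \<Longrightarrow>
      norm (x i) \<le> (\<Sum>\<^sub>\<infinity>m. slanted_decay \<alpha> D m i * norm (mat_apply A x m))"
proof -
  obtain \<kappa> where \<kappa>: "0 < \<kappa>" "\<And>x. x \<in> lp p \<Longrightarrow> \<kappa> * lp_norm p x \<le> lp_norm p (mat_apply A x)"
    using below by (auto simp: bounded_below_lp_def)
  obtain S where S: "\<And>C. 0 < C \<Longrightarrow> schur (slanted_decay \<alpha> C :: int ^ 'd \<Rightarrow> int ^ 'd \<Rightarrow> real) (C * S)"
    "\<And>C. 0 < C \<Longrightarrow> schur (strong_decay \<alpha> C :: int ^ 'd \<Rightarrow> int ^ 'd \<Rightarrow> real) (C * S)" "0 < S"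
    by (rule schur_decay[OF \<alpha>, where 'd='d]) (rule that)
  obtain R where R: "\<And>C. 0 < C \<Longrightarrow> schur (slanted_decay 1 C :: int ^ 'd \<Rightarrow> int ^ 'd \<Rightarrow> real) (C * R)"
    using schur_decay[OF one_neq_zero, where 'd='d] by metis
  \<comment> \<open>With the factor 4 of the quasi-triangle inequality the defect consumes at most half of \<open>\<kappa>\<close>.\<close>
  define \<epsilon> where "\<epsilon> = min 1 (\<kappa> / (8 * C * S))"
  have \<epsilon>: "0 < \<epsilon>" "\<epsilon> \<le> 1" "4 * (\<epsilon> * C * S) \<le> \<kappa> / 2"
  proof -
    show "0 < \<epsilon>" "\<epsilon> \<le> 1" using \<kappa> C S by (auto simp: \<epsilon>_def)
    have "\<epsilon> * (8 * C * S) \<le> \<kappa> / (8 * C * S) * (8 * C * S)"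
      using C S by (intro mult_right_mono) (auto simp: \<epsilon>_def)
    then show "4 * (\<epsilon> * C * S) \<le> \<kappa> / 2" using C S by simp
  qed
  define N where "N = 1 / \<epsilon> ^ (2 * CARD('d))"
  have N: "0 < N" using \<epsilon> by (simp add: N_def)
  note kA = S(2)[OF C]
  show thesis
  proof (rule that[of "8 / \<kappa> * N"])
    show "0 < 8 / \<kappa> * N" using N \<kappa> by simp
    fix x :: "int ^ 'd \<Rightarrow> 'x" and X i assume x: "\<And>n. norm (x n) \<le> X"
    define r where "r = (\<lambda>m :: int ^ 'd. cutoff \<epsilon> (node 1 i) (node \<alpha> m))"
    define s where "s = (\<lambda>n :: int ^ 'd. cutoff \<epsilon> (node 1 i) (node 1 n))"
    define E where "E = entry_defect (\<lambda>m n. r m / s n) A"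
    define y where "y = (\<lambda>n. s n *\<^sub>R x n)"
    define b where "b = (\<lambda>m. r m *\<^sub>R mat_apply A x m)"
    have rs: "0 < r m" "0 < s m" "s m \<le> 1" for m
      by (simp_all add: r_def s_def cutoff_pos cutoff_le_1)
    have E: "dominated E (slanted_decay \<alpha> (\<epsilon> * C))"
      unfolding E_def r_def s_def by (rule dominated_entry_defect[OF A C cutoff_ratio[OF \<epsilon>(1,2)]])
    have kE: "schur (slanted_decay \<alpha> (\<epsilon> * C) :: int ^ 'd \<Rightarrow> int ^ 'd \<Rightarrow> real) (\<epsilon> * C * S)"
      using \<epsilon> C by (intro S) simp
    have y_le: "norm (y n) \<le> X" for n
    proof -
      have "norm (y n) \<le> 1 * norm (x n)"
        using rs[of n] by (auto simp: y_def less_imp_le intro: mult_left_le_one_le)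
      then show ?thesis using x[of n] by simp
    qed
    have eq: "b m = mat_apply A y m - mat_apply E y m" for m
      unfolding b_def E_def using rs
      by (intro mat_apply_entry_defect[OF A kA E[unfolded E_def] kE y_le, symmetric])
         (auto simp: y_def less_imp_neq[symmetric])
    have s_le: "s n \<le> slanted_decay 1 N n i" for n
      using cutoff_le[OF \<epsilon>(1,2), of "node 1 i" "node 1 n"] by (simp add: s_def slanted_decay_def N_def)
    have r_le: "r m \<le> slanted_decay \<alpha> N m i" for m
      using cutoff_le[OF \<epsilon>(1,2), of "node 1 i" "node \<alpha> m"] by (simp add: r_def slanted_decay_def N_def)
    have "(\<lambda>n. slanted_decay 1 N n i * norm (x n)) summable_on UNIV"
      by (rule schur_row_bounded_summable[OF schur_transpose[OF R[OF N]] norm_ge_zero x])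
    then have "(\<lambda>n. norm (y n)) summable_on UNIV"
      by (rule summable_on_comparison_test)
         (use rs s_le in \<open>auto simp: y_def less_imp_le intro: mult_right_mono\<close>)
    then have y: "y \<in> lp p" by (rule lp_of_summable[OF p])
    have sb0: "(\<lambda>m. slanted_decay \<alpha> N m i * norm (mat_apply A x m)) summable_on UNIV"
      by (rule schur_row_bounded_summable[OF schur_transpose[OF S(1)[OF N]] norm_ge_zero
            mat_apply_bounded[OF A kA x]])
    have b_le: "norm (b m) \<le> slanted_decay \<alpha> N m i * norm (mat_apply A x m)" for m
      using rs[of m] r_le[of m] by (auto simp: b_def less_imp_le intro: mult_right_mono)
    have sb: "(\<lambda>m. norm (b m)) summable_on UNIV"
      by (rule summable_on_comparison_test[OF sb0 b_le]) auto
    note b = lp_of_summable[OF p sb]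
    note Ey = mat_apply_lp[OF p y E kE]
    have "\<kappa> * lp_norm p y \<le> lp_norm p (mat_apply A y)" by (rule \<kappa>(2)[OF y])
    also have "\<dots> \<le> 4 * (lp_norm p b + lp_norm p (mat_apply E y))"
    proof (rule lp_norm_quasi_triangle[OF p b(1) Ey(1)])
      fix m
      have "mat_apply A y m = b m + mat_apply E y m" by (simp add: eq)
      then show "norm (mat_apply A y m) \<le> norm (b m) + norm (mat_apply E y m)"
        by (simp add: norm_triangle_ineq)
    qed
    also have "\<dots> \<le> 4 * (lp_norm p b + \<epsilon> * C * S * lp_norm p y)"
      using Ey(2) by simp
    also have "\<dots> = 4 * lp_norm p b + 4 * (\<epsilon> * C * S) * lp_norm p y" by simp
    also have "\<dots> \<le> 4 * lp_norm p b + \<kappa> / 2 * lp_norm p y"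
      using mult_right_mono[OF \<epsilon>(3) lp_norm_nonneg[OF y]] by simp
    finally have *: "\<kappa> * lp_norm p y \<le> 8 * lp_norm p b" by simp
    have "norm (x i) = norm (y i)" by (simp add: y_def s_def)
    also have "\<dots> \<le> lp_norm p y" by (rule norm_le_lp_norm[OF p y])
    also have "\<dots> \<le> 8 / \<kappa> * lp_norm p b" using * \<kappa> by (simp add: field_simps)
    also have "\<dots> \<le> 8 / \<kappa> * (\<Sum>\<^sub>\<infinity>m. slanted_decay \<alpha> N m i * norm (mat_apply A x m))"
      using \<kappa> by (intro mult_left_mono order_trans[OF b(2)] infsum_mono sb sb0 b_le) auto
    also have "\<dots> = (\<Sum>\<^sub>\<infinity>m. slanted_decay \<alpha> (8 / \<kappa> * N) m i * norm (mat_apply A x m))"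
      by (simp add: infsum_cmult_right'[symmetric] slanted_decay_def mult.assoc)
    finally show "norm (x i) \<le> (\<Sum>\<^sub>\<infinity>m. slanted_decay \<alpha> (8 / \<kappa> * N) m i * norm (mat_apply A x m))" .
  qed
qed

text \<open>The pointwise estimate bounds \<open>x\<close> by a Schur kernel applied to \<open>A x\<close>, and the Schur test
  holds for all exponents.\<close>
theorem bounded_below_lp_independent:
  fixes A :: "('d::finite, 'x::complex_hilbert, 'y::complex_hilbert) op_matrix"
  assumes \<alpha>: "\<alpha> \<noteq> 0" and A: "dominated A (strong_decay \<alpha> C)" and C: "0 < C"
    and p: "1 \<le> p" and below: "bounded_below_lp p A" and q: "1 \<le> q"
  shows "bounded_below_lp q A"
proof -
  obtain D where D: "0 < D" "\<And>x X i. (\<And>n. norm (x n) \<le> X) \<Longrightarrow>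
      norm (x i) \<le> (\<Sum>\<^sub>\<infinity>m. slanted_decay \<alpha> D m i * norm (mat_apply A x m))"
    using stability_pointwise[OF \<alpha> A C p below] by metis
  obtain S where S: "\<And>C. 0 < C \<Longrightarrow> schur (slanted_decay \<alpha> C :: int ^ 'd \<Rightarrow> int ^ 'd \<Rightarrow> real) (C * S)"
    "\<And>C. 0 < C \<Longrightarrow> schur (strong_decay \<alpha> C :: int ^ 'd \<Rightarrow> int ^ 'd \<Rightarrow> real) (C * S)" "0 < S"
    by (rule schur_decay[OF \<alpha>, where 'd='d]) (rule that)
  have "lp_norm q x \<le> D * S * lp_norm q (mat_apply A x)" if x: "x \<in> lp q" for x
    by (rule lp_schur_test(2)[OF q mat_apply_lp(1)[OF q x A S(2)[OF C]] schur_transpose[OF S(1)[OF D(1)]]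
          D(2)[OF norm_le_lp_norm[OF q x]]])
  then have "(1 / (D * S)) * lp_norm q x \<le> lp_norm q (mat_apply A x)" if "x \<in> lp q" for x
    using that D(1) S(3) by (simp add: field_simps)
  moreover have "0 < 1 / (D * S)" using D(1) S(3) by simp
  ultimately show ?thesis unfolding bounded_below_lp_def by blast
qed

section \<open>Projections and least squares in Hilbert space\<close>

text \<open>A minimising sequence for the distance from \<open>y\<close> is Cauchy by the parallelogram law, and
  minimality of its limit \<open>p\<close> along each line \<open>p + t z\<close> gives orthogonality.\<close>
lemma orthogonal_projection_exists:
  fixes S :: "'a::real_inner set" and y :: 'a
  assumes sub: "subspace S" and S: "complete S"
  obtains p where "p \<in> S" "\<And>z. z \<in> S \<Longrightarrow> inner (y - p) z = 0"
proof -
  define d where "d = (INF s\<in>S. (norm (y - s))\<^sup>2)"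
  have bdd: "bdd_below ((\<lambda>s. (norm (y - s))\<^sup>2) ` S)"
    by (rule bdd_belowI2[of _ 0]) auto
  have ne: "S \<noteq> {}" using sub subspace_0 by blast
  have d_le: "d \<le> (norm (y - s))\<^sup>2" if "s \<in> S" for s
    unfolding d_def using that bdd by (rule cINF_lower[rotated])
  have "\<exists>s\<in>S. (norm (y - s))\<^sup>2 < d + 1 / real (Suc n)" for n
    using cINF_less_iff[OF ne bdd, of "d + 1 / real (Suc n)"] by (simp add: d_def)
  then obtain s where s: "\<And>n. s n \<in> S" "\<And>n. (norm (y - s n))\<^sup>2 < d + 1 / real (Suc n)"
    by metis
  have par: "(norm (s m - s n))\<^sup>2 \<le> 2 / real (Suc m) + 2 / real (Suc n)" for m n
  proof -
    define u v where "u = y - s m" and "v = y - s n"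
    have "(norm (v - u))\<^sup>2 + (norm (u + v))\<^sup>2 = 2 * (norm u)\<^sup>2 + 2 * (norm v)\<^sup>2"
      by (simp add: power2_norm_eq_inner inner_diff_left inner_diff_right inner_add_left
          inner_add_right inner_commute)
    moreover have "v - u = s m - s n" by (simp add: u_def v_def)
    moreover have "(norm (u + v))\<^sup>2 = 4 * (norm (y - (1/2) *\<^sub>R (s m + s n)))\<^sup>2"
    proof -
      have "u + v = 2 *\<^sub>R (y - (1/2) *\<^sub>R (s m + s n))"
        by (simp add: u_def v_def scaleR_diff_right scaleR_add_right scaleR_2)
      then show ?thesis by (simp add: power_mult_distrib)
    qed
    ultimately have "(norm (s m - s n))\<^sup>2 = 2 * (norm (y - s m))\<^sup>2 + 2 * (norm (y - s n))\<^sup>2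
        - 4 * (norm (y - (1/2) *\<^sub>R (s m + s n)))\<^sup>2"
      by (simp add: u_def v_def)
    moreover have "d \<le> (norm (y - (1/2) *\<^sub>R (s m + s n)))\<^sup>2"
      by (intro d_le subspace_mul[OF sub] subspace_add[OF sub] s)
    moreover have "2 / real (Suc m) = 2 * (1 / real (Suc m))" "2 / real (Suc n) = 2 * (1 / real (Suc n))"
      by simp_all
    ultimately show ?thesis using s(2)[of m] s(2)[of n] by argo
  qed
  have "Cauchy s"
  proof (rule metric_CauchyI)
    fix e :: real assume e: "0 < e"
    obtain N where N: "1 / real (Suc N) < e\<^sup>2 / 4"
      using nat_approx_posE[of "e\<^sup>2 / 4"] e by auto
    have "dist (s m) (s n) < e" if "N \<le> m" "N \<le> n" for m n
    proof -
      have "1 / real (Suc m) \<le> 1 / real (Suc N)" "1 / real (Suc n) \<le> 1 / real (Suc N)"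
        using that by (auto simp: frac_le)
      then have "(norm (s m - s n))\<^sup>2 < e\<^sup>2"
        using par[of m n] N by linarith
      then show ?thesis
        using e by (simp add: dist_norm power2_less_imp_less)
    qed
    then show "\<exists>M. \<forall>m\<ge>M. \<forall>n\<ge>M. dist (s m) (s n) < e" by blast
  qed
  then obtain p where p: "p \<in> S" "s \<longlonglongrightarrow> p"
    using S s(1) unfolding complete_def by blast
  have lim1: "(\<lambda>n. d + 1 / real (Suc n)) \<longlonglongrightarrow> d + 0"
    by (rule tendsto_add[OF tendsto_const LIMSEQ_Suc[OF lim_1_over_n]])
  have lim2: "(\<lambda>n. (norm (y - s n))\<^sup>2) \<longlonglongrightarrow> (norm (y - p))\<^sup>2"
    by (intro tendsto_intros p)
  have "(norm (y - p))\<^sup>2 \<le> d + 0"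
    by (rule LIMSEQ_le[OF lim2 lim1]) (use less_imp_le[OF s(2)] in blast)
  then have min: "(norm (y - p))\<^sup>2 \<le> d" by simp
  have "inner (y - p) z = 0" if z: "z \<in> S" for z
  proof (cases "z = 0")
    case False
    define w where "w = inner (y - p) z"
    \<comment> \<open>The minimiser of the distance from \<open>y\<close> to \<open>p + t z\<close>.\<close>
    define t where "t = w / (norm z)\<^sup>2"
    have "d \<le> (norm (y - (p + t *\<^sub>R z)))\<^sup>2"
      by (intro d_le subspace_add[OF sub] subspace_mul[OF sub] p z)
    also have "\<dots> = (norm (y - p))\<^sup>2 - 2 * t * w + t\<^sup>2 * (norm z)\<^sup>2"
    proof -
      have "(norm (u - t *\<^sub>R z))\<^sup>2 = (norm u)\<^sup>2 - 2 * t * inner u z + t\<^sup>2 * (norm z)\<^sup>2" for u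
        unfolding power2_norm_eq_inner inner_diff_left inner_diff_right inner_scaleR_left
          inner_scaleR_right inner_commute[of z u]
        by (simp add: power2_eq_square right_diff_distrib)
      from this[of "y - p"] show ?thesis by (simp add: w_def diff_diff_eq)
    qed
    also have "\<dots> = (norm (y - p))\<^sup>2 - w\<^sup>2 / (norm z)\<^sup>2"
      using False by (simp add: t_def power2_eq_square)
    finally have "w\<^sup>2 / (norm z)\<^sup>2 \<le> 0" using min by simp
    then show ?thesis using False by (simp add: w_def divide_le_0_iff)
  qed simp
  then show thesis using that p by blast
qed

definition least_squares :: "('a::real_inner \<Rightarrow> 'b::real_inner) \<Rightarrow> 'b \<Rightarrow> 'a"
  where "least_squares T y = (THE x. \<forall>z. inner (T x - y) (T z) = 0)"

lemma least_squares_eqI: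
  assumes T: "bounded_linear T" "0 < \<kappa>" "\<And>x. \<kappa> * norm x \<le> norm (T x)"
    and x: "\<And>z. inner (T x - y) (T z) = 0"
  shows "least_squares T y = x"
  unfolding least_squares_def
proof (rule the_equality)
  fix x' assume x': "\<forall>z. inner (T x' - y) (T z) = 0"
  have "inner (T (x' - x)) (T (x' - x)) = inner (T x' - y) (T (x' - x)) - inner (T x - y) (T (x' - x))"
    by (simp add: linear_diff[OF bounded_linear.linear[OF T(1)]] inner_diff_left)
  also have "\<dots> = 0" using x x' by simp
  finally have "T (x' - x) = 0" by simp
  then have "\<kappa> * norm (x' - x) \<le> 0" using T(3)[of "x' - x"] by simp
  then have "norm (x' - x) \<le> 0" using T(2) by (simp add: mult_le_0_iff)
  then show "x' = x" by simp
qed (use x in simp)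

text \<open>A lower bound makes the range of \<open>T\<close> complete, so \<open>y\<close> has an orthogonal projection onto it.\<close>
lemma least_squares_normal:
  fixes T :: "'a::{real_inner, banach} \<Rightarrow> 'b::real_inner"
  assumes T: "bounded_linear T" "0 < \<kappa>" "\<And>x. \<kappa> * norm x \<le> norm (T x)"
  shows "inner (T (least_squares T y) - y) (T z) = 0"
proof -
  have "complete (range T)"
    using T by (intro complete_isometric_image[of \<kappa>]) (auto simp: complete_UNIV)
  moreover have "subspace (range T)"
    by (rule linear_subspace_image[OF bounded_linear.linear[OF T(1)] subspace_UNIV])
  ultimately obtain p where p: "p \<in> range T" "\<And>z. z \<in> range T \<Longrightarrow> inner (y - p) z = 0"
    using orthogonal_projection_exists by metis
  then obtain x where x: "p = T x" by auto
  have *: "inner (T x - y) (T z) = 0" for z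
    using p(2)[of "T z"] by (simp add: x inner_diff_left)
  then have "least_squares T y = x" by (rule least_squares_eqI[OF T])
  then show ?thesis using * by simp
qed

lemma least_squares_inverse:
  assumes T: "bounded_linear T" "0 < \<kappa>" "\<And>x. \<kappa> * norm x \<le> norm (T x)"
  shows "least_squares T (T x) = x"
  by (rule least_squares_eqI[OF T]) simp

lemma bounded_linear_least_squares:
  fixes T :: "'a::{real_inner, banach} \<Rightarrow> 'b::real_inner"
  assumes T: "bounded_linear T" "0 < \<kappa>" "\<And>x. \<kappa> * norm x \<le> norm (T x)"
  shows "bounded_linear (least_squares T)"
proof (rule bounded_linear_intro)
  note lin = bounded_linear.linear[OF T(1)]
  note N = least_squares_normal[OF T]
  fix x y and r :: real
  show "least_squares T (x + y) = least_squares T x + least_squares T y"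
  proof (rule least_squares_eqI[OF T])
    show "inner (T (least_squares T x + least_squares T y) - (x + y)) (T z) = 0" for z
      using N[of x z] N[of y z] by (simp add: linear_add[OF lin] inner_diff_left inner_add_left)
  qed
  show "least_squares T (r *\<^sub>R x) = r *\<^sub>R least_squares T x"
  proof (rule least_squares_eqI[OF T])
    show "inner (T (r *\<^sub>R least_squares T x) - r *\<^sub>R x) (T z) = 0" for z
      using N[of x z] by (simp add: linear_cmul[OF lin] inner_diff_left)
  qed
  define t where "t = T (least_squares T x)"
  have "inner t t = inner x t"
    using N[of x "least_squares T x"] by (simp add: t_def inner_diff_left)
  then have "(norm t)\<^sup>2 \<le> norm x * norm t"
    using norm_cauchy_schwarz[of x t] by (simp add: power2_norm_eq_inner)
  then have "norm t \<le> norm x"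
    by (cases "t = 0") (simp_all add: power2_eq_square)
  then have "\<kappa> * norm (least_squares T x) \<le> norm x"
    using T(3)[of "least_squares T x"] by (simp add: t_def)
  then show "norm (least_squares T x) \<le> norm x * (1 / \<kappa>)"
    using T(2) by (simp add: field_simps)
qed

section \<open>The Hilbert space of square summable families\<close>

text \<open>A type of its own, so that inner product, norm and completeness become class instances
  and the Hilbert space lemmas apply to it.\<close>
typedef (overloaded) ('i, 'a) l2 =
  "{f :: 'i \<Rightarrow> 'a::real_inner. (\<lambda>i. (norm (f i))\<^sup>2) summable_on UNIV}"
  morphisms coord Abs_l2
  by (rule exI[of _ "\<lambda>_. 0"]) simp

setup_lifting type_definition_l2

lemma coord_square_summable: "(\<lambda>i. (norm (coord x i))\<^sup>2) summable_on UNIV"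
  using coord[of x] by simp

lemma l2_eqI: "(\<And>i. coord x i = coord y i) \<Longrightarrow> x = y"
  by (simp add: coord_inject[symmetric] fun_eq_iff)

lemma square_summable_add:
  fixes f g :: "'i \<Rightarrow> 'a::real_inner"
  assumes "(\<lambda>i. (norm (f i))\<^sup>2) summable_on UNIV" "(\<lambda>i. (norm (g i))\<^sup>2) summable_on UNIV"
  shows "(\<lambda>i. (norm (f i + g i))\<^sup>2) summable_on UNIV"
proof (rule summable_on_comparison_test)
  show "(\<lambda>i. 2 * ((norm (f i))\<^sup>2 + (norm (g i))\<^sup>2)) summable_on UNIV"
    by (intro summable_on_cmult_right summable_on_add assms)
  fix i
  have "(norm (f i + g i))\<^sup>2 \<le> (norm (f i) + norm (g i))\<^sup>2"
    by (intro power_mono norm_triangle_ineq) auto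
  also have "\<dots> \<le> 2 * ((norm (f i))\<^sup>2 + (norm (g i))\<^sup>2)"
    using zero_le_power2[of "norm (f i) - norm (g i)"]
    by (simp add: power2_eq_square algebra_simps)
  finally show "(norm (f i + g i))\<^sup>2 \<le> 2 * ((norm (f i))\<^sup>2 + (norm (g i))\<^sup>2)" .
qed auto

lemma square_summable_inner:
  fixes f g :: "'i \<Rightarrow> 'a::real_inner"
  assumes "(\<lambda>i. (norm (f i))\<^sup>2) summable_on UNIV" "(\<lambda>i. (norm (g i))\<^sup>2) summable_on UNIV"
  shows "(\<lambda>i. inner (f i) (g i)) summable_on UNIV"
proof -
  have "(\<lambda>i. norm (inner (f i) (g i))) summable_on UNIV"
  proof (rule Infinite_Sum.abs_summable_on_comparison_test')
    show "(\<lambda>i. (norm (f i))\<^sup>2 + (norm (g i))\<^sup>2) summable_on UNIV"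
      by (intro summable_on_add assms)
    fix i
    have "norm (inner (f i) (g i)) \<le> norm (f i) * norm (g i)"
      by (simp add: Cauchy_Schwarz_ineq2)
    also have "\<dots> \<le> (norm (f i))\<^sup>2 + (norm (g i))\<^sup>2"
      using zero_le_power2[of "norm (f i) - norm (g i)"]
        mult_nonneg_nonneg[OF norm_ge_zero[of "f i"] norm_ge_zero[of "g i"]]
      unfolding power2_diff by linarith
    finally show "norm (inner (f i) (g i)) \<le> (norm (f i))\<^sup>2 + (norm (g i))\<^sup>2" .
  qed
  then show ?thesis by (rule abs_summable_summable)
qed

instantiation l2 :: (type, real_inner) real_inner
begin

lift_definition zero_l2 :: "('a, 'b) l2" is "\<lambda>_. 0" by simp
lift_definition plus_l2 :: "('a, 'b) l2 \<Rightarrow> ('a, 'b) l2 \<Rightarrow> ('a, 'b) l2" is "\<lambda>f g i. f i + g i"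
  by (rule square_summable_add)
lift_definition uminus_l2 :: "('a, 'b) l2 \<Rightarrow> ('a, 'b) l2" is "\<lambda>f i. - f i" by simp
lift_definition minus_l2 :: "('a, 'b) l2 \<Rightarrow> ('a, 'b) l2 \<Rightarrow> ('a, 'b) l2" is "\<lambda>f g i. f i - g i"
  subgoal for f g using square_summable_add[of f "\<lambda>i. - g i"] by simp
  done
lift_definition scaleR_l2 :: "real \<Rightarrow> ('a, 'b) l2 \<Rightarrow> ('a, 'b) l2" is "\<lambda>c f i. c *\<^sub>R f i"
  by (simp add: power_mult_distrib summable_on_cmult_right)
lift_definition inner_l2 :: "('a, 'b) l2 \<Rightarrow> ('a, 'b) l2 \<Rightarrow> real"
  is "\<lambda>f g. \<Sum>\<^sub>\<infinity>i. inner (f i) (g i)" .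

definition norm_l2 :: "('a, 'b) l2 \<Rightarrow> real" where "norm_l2 x = sqrt (inner x x)"
definition dist_l2 :: "('a, 'b) l2 \<Rightarrow> ('a, 'b) l2 \<Rightarrow> real" where "dist_l2 x y = norm (x - y)"
definition sgn_l2 :: "('a, 'b) l2 \<Rightarrow> ('a, 'b) l2" where "sgn_l2 x = inverse (norm x) *\<^sub>R x"
definition uniformity_l2 :: "(('a, 'b) l2 \<times> ('a, 'b) l2) filter"
  where "uniformity_l2 = (INF e\<in>{0<..}. principal {(x, y). dist x y < e})"
definition open_l2 :: "('a, 'b) l2 set \<Rightarrow> bool"
  where "open_l2 U = (\<forall>x\<in>U. \<forall>\<^sub>F (x', y) in uniformity. x' = x \<longrightarrow> y \<in> U)"

instance
proof
  fix x y z :: "('a, 'b) l2" and r s :: real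
  show "x + y + z = x + (y + z)"
    by transfer (simp add: add.assoc)
  show "x + y = y + x"
    by transfer (simp add: add.commute)
  show "0 + x = x" by transfer simp
  show "- x + x = 0" by transfer simp
  show "x - y = x + - y" by transfer simp
  show "r *\<^sub>R (x + y) = r *\<^sub>R x + r *\<^sub>R y" by transfer (simp add: scaleR_add_right)
  show "(r + s) *\<^sub>R x = r *\<^sub>R x + s *\<^sub>R x" by transfer (simp add: scaleR_add_left)
  show "r *\<^sub>R s *\<^sub>R x = (r * s) *\<^sub>R x" by transfer simp
  show "1 *\<^sub>R x = x" by transfer simp
  show "dist x y = norm (x - y)" "sgn x = inverse (norm x) *\<^sub>R x"
    by (simp_all add: dist_l2_def sgn_l2_def)
  show "uniformity = (INF e\<in>{0<..}. principal {(x :: ('a, 'b) l2, y). dist x y < e})"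
    by (rule uniformity_l2_def)
  show "open U \<longleftrightarrow> (\<forall>x\<in>U. \<forall>\<^sub>F (x', y) in uniformity. x' = x \<longrightarrow> y \<in> U)" for U :: "('a, 'b) l2 set"
    by (rule open_l2_def)
  show "inner x y = inner y x"
    by transfer (simp add: inner_commute)
  show "inner (x + y) z = inner x z + inner y z"
    by transfer (simp add: inner_add_left infsum_add square_summable_inner)
  show "inner (r *\<^sub>R x) y = r * inner x y"
    by transfer (simp add: infsum_cmult_right')
  show "0 \<le> inner x x"
    by transfer (simp add: infsum_nonneg)
  show "inner x x = 0 \<longleftrightarrow> x = 0"
  proof transfer
    fix f :: "'a \<Rightarrow> 'b" assume f: "(\<lambda>i. (norm (f i))\<^sup>2) summable_on UNIV"
    show "(\<Sum>\<^sub>\<infinity>i. inner (f i) (f i)) = 0 \<longleftrightarrow> f = (\<lambda>_. 0)"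
    proof
      assume 0: "(\<Sum>\<^sub>\<infinity>i. inner (f i) (f i)) = 0"
      have "inner (f i) (f i) = 0" for i
        using nonneg_infsum_le_0D[of "\<lambda>i. inner (f i) (f i)" UNIV i] 0 f
        by (simp add: power2_norm_eq_inner)
      then show "f = (\<lambda>_. 0)" by (simp add: fun_eq_iff)
    qed simp
  qed
  show "norm x = sqrt (inner x x)" by (rule norm_l2_def)
qed

end

lemma coord_simps [simp]:
  "coord 0 i = 0" "coord (x + y) i = coord x i + coord y i" "coord (- x) i = - coord x i"
  "coord (x - y) i = coord x i - coord y i" "coord (c *\<^sub>R x) i = c *\<^sub>R coord x i"
  by (simp_all add: zero_l2.rep_eq plus_l2.rep_eq uminus_l2.rep_eq minus_l2.rep_eq scaleR_l2.rep_eq)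

lemma inner_l2_eq: "inner x y = (\<Sum>\<^sub>\<infinity>i. inner (coord x i) (coord y i))"
  by (simp add: inner_l2.rep_eq)

lemma norm_l2_square: "(norm x)\<^sup>2 = (\<Sum>\<^sub>\<infinity>i. (norm (coord x i))\<^sup>2)"
  unfolding power2_norm_eq_inner by (rule inner_l2_eq)

lemma norm_coord_le: "norm (coord x i) \<le> norm x"
proof -
  have "(\<Sum>j\<in>{i}. (norm (coord x j))\<^sup>2) \<le> (norm x)\<^sup>2"
    unfolding norm_l2_square by (rule finite_sum_le_infsum[OF coord_square_summable]) auto
  then show ?thesis by (auto intro: power2_le_imp_le)
qed

lemma bounded_linear_coord: "bounded_linear (\<lambda>x. coord x i)"
  by (rule bounded_linear_intro[where K = 1]) (auto simp: norm_coord_le)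

instance l2 :: (type, "{real_inner, banach}") banach
proof
  fix X :: "nat \<Rightarrow> ('a, 'b) l2" assume X: "Cauchy X"
  have "Cauchy (\<lambda>n. coord (X n) i)" for i
    using bounded_linear.Cauchy[OF bounded_linear_coord X] .
  then obtain L where L: "\<And>i. (\<lambda>n. coord (X n) i) \<longlonglongrightarrow> L i"
    unfolding Cauchy_convergent_iff convergent_def by metis
  have tail: "\<exists>N. \<forall>n\<ge>N. \<forall>F. finite F \<longrightarrow> (\<Sum>i\<in>F. (norm (coord (X n) i - L i))\<^sup>2) \<le> e\<^sup>2"
    if e: "0 < e" for e
  proof -
    obtain N where N: "\<And>m n. N \<le> m \<Longrightarrow> N \<le> n \<Longrightarrow> norm (X n - X m) < e"
      using X e by (metis CauchyD)
    have "(\<Sum>i\<in>F. (norm (coord (X n) i - L i))\<^sup>2) \<le> e\<^sup>2" if "N \<le> n" "finite F" for n F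
    proof (rule LIMSEQ_le_const2)
      show "(\<lambda>m. \<Sum>i\<in>F. (norm (coord (X n) i - coord (X m) i))\<^sup>2)
          \<longlonglongrightarrow> (\<Sum>i\<in>F. (norm (coord (X n) i - L i))\<^sup>2)"
        by (intro tendsto_intros L)
      have "(\<Sum>i\<in>F. (norm (coord (X n) i - coord (X m) i))\<^sup>2) \<le> e\<^sup>2" if m: "N \<le> m" for m
      proof -
        have "(\<Sum>i\<in>F. (norm (coord (X n - X m) i))\<^sup>2) \<le> (norm (X n - X m))\<^sup>2"
          unfolding norm_l2_square using \<open>finite F\<close>
          by (intro finite_sum_le_infsum coord_square_summable) auto
        also have "\<dots> \<le> e\<^sup>2"
          using N[OF m \<open>N \<le> n\<close>] by (intro power_mono) auto
        finally show ?thesis by simp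
      qed
      then show "\<exists>N. \<forall>m\<ge>N. (\<Sum>i\<in>F. (norm (coord (X n) i - coord (X m) i))\<^sup>2) \<le> e\<^sup>2"
        by blast
    qed
    then show ?thesis by blast
  qed
  have diff: "(\<lambda>i. (norm (coord (X n) i - L i))\<^sup>2) summable_on UNIV"
    if "\<forall>F. finite F \<longrightarrow> (\<Sum>i\<in>F. (norm (coord (X n) i - L i))\<^sup>2) \<le> e\<^sup>2" for n e
    using that by (intro nonneg_bdd_above_summable_on bdd_aboveI2[of _ _ "e\<^sup>2"]) auto
  obtain N where "\<forall>F. finite F \<longrightarrow> (\<Sum>i\<in>F. (norm (coord (X N) i - L i))\<^sup>2) \<le> 1\<^sup>2"
    using tail[of 1] by auto
  from square_summable_add[OF coord_square_summable[of "X N"], of "\<lambda>i. - (coord (X N) i - L i)"]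
    diff[OF this]
  have Lsum: "(\<lambda>i. (norm (L i))\<^sup>2) summable_on UNIV"
    by (simp add: norm_minus_commute)
  define l where "l = Abs_l2 L"
  have l: "coord l = L" unfolding l_def using Lsum by (intro Abs_l2_inverse) simp
  have "X \<longlonglongrightarrow> l"
  proof (rule metric_LIMSEQ_I)
    fix r :: real assume r: "0 < r"
    then obtain N where N: "\<forall>n\<ge>N. \<forall>F. finite F \<longrightarrow>
        (\<Sum>i\<in>F. (norm (coord (X n) i - L i))\<^sup>2) \<le> (r / 2)\<^sup>2"
      using tail[of "r / 2"] by auto
    have "dist (X n) l < r" if n: "N \<le> n" for n
    proof -
      have "(norm (X n - l))\<^sup>2 \<le> (r / 2)\<^sup>2"
        unfolding norm_l2_square using N n diff
        by (intro infsum_le_finite_sums) (auto simp: l)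
      then show ?thesis
        using r power2_le_imp_le[of "norm (X n - l)" "r / 2"] by (simp add: dist_norm)
    qed
    then show "\<exists>N. \<forall>n\<ge>N. dist (X n) l < r" by blast
  qed
  then show "convergent X" by (auto simp: convergent_def)
qed

lift_definition single :: "'i \<Rightarrow> 'a \<Rightarrow> ('i, 'a::real_inner) l2"
  is "\<lambda>i v j. if j = i then v else 0"
  subgoal for i v
    by (rule finite_nonzero_values_imp_summable_on, rule finite_subset[of _ "{i}"]) auto
  done

lemma coord_single: "coord (single i v) j = (if j = i then v else 0)"
  by transfer simp

lemma norm_single [simp]: "norm (single i v) = norm v"
proof -
  have "(norm (single i v))\<^sup>2 = (\<Sum>\<^sub>\<infinity>j\<in>{i}. (norm (coord (single i v) j))\<^sup>2)"
    unfolding norm_l2_square by (rule infsum_cong_neutral) (auto simp: coord_single)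
  also have "\<dots> = (norm v)\<^sup>2" by (simp add: coord_single)
  finally show ?thesis by (rule power2_eq_imp_eq) auto
qed

text \<open>Absolute summability yields some limit in the Banach space, and evaluation of the
  coordinates identifies it.\<close>
lemma has_sum_single_coord:
  fixes y :: "('i, 'a::{real_inner, banach}) l2"
  assumes "(\<lambda>i. norm (coord y i)) summable_on UNIV"
  shows "((\<lambda>i. single i (coord y i)) has_sum y) UNIV"
proof -
  have "(\<lambda>i. norm (single i (coord y i))) summable_on UNIV"
    unfolding norm_single by (rule assms)
  then have "(\<lambda>i. single i (coord y i)) summable_on UNIV"
    by (rule abs_summable_summable)
  then obtain z where z: "((\<lambda>i. single i (coord y i)) has_sum z) UNIV"
    unfolding summable_on_def by blast
  have "coord z j = coord y j" for j
  proof -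
    have "((\<lambda>i. coord (single i (coord y i)) j) has_sum coord z j) UNIV"
      using has_sum_bounded_linear[OF bounded_linear_coord z] unfolding o_def .
    moreover have "((\<lambda>i. coord (single i (coord y i)) j) has_sum coord y j) UNIV"
      by (rule has_sum_finite_neutralI[of "{j}"]) (auto simp: coord_single)
    ultimately show ?thesis by (rule has_sum_unique)
  qed
  then have "z = y" by (rule l2_eqI)
  with z show ?thesis by simp
qed

section \<open>Matrices and multipliers on square summable families\<close>

lemma lp_2: "lp 2 = {f. (\<lambda>n. (norm (f n))\<^sup>2) summable_on UNIV}"
  by (simp add: lp_def)

lemma coord_in_lp: "coord x \<in> lp 2"
  unfolding lp_2 using coord_square_summable[of x] by simp

lemma coord_Abs_l2: "f \<in> lp 2 \<Longrightarrow> coord (Abs_l2 f) = f"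
  unfolding lp_2 by (rule Abs_l2_inverse)

lemma norm_l2_lp: "norm x = lp_norm 2 (coord x)"
proof -
  have "lp_norm 2 (coord x) = ((norm x)\<^sup>2) powr (1 / 2)"
    unfolding norm_l2_square by (simp add: lp_norm_def)
  then show ?thesis by (simp add: powr_half_sqrt)
qed

definition l2_op ::
    "('d::finite, 'x::complex_hilbert, 'y::complex_hilbert) op_matrix \<Rightarrow> (int ^ 'd, 'x) l2 \<Rightarrow> (int ^ 'd, 'y) l2"
  where "l2_op A x = Abs_l2 (mat_apply A (coord x))"

lemma coord_l2_op:
  assumes "dominated A k" "schur k S"
  shows "coord (l2_op A x) = mat_apply A (coord x)"
  unfolding l2_op_def by (intro coord_Abs_l2 mat_apply_lp(1)[OF _ coord_in_lp assms]) simp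

lemma norm_l2_op_le:
  assumes "dominated A k" "schur k S"
  shows "norm (l2_op A x) \<le> S * norm x"
  unfolding norm_l2_lp coord_l2_op[OF assms]
  by (intro mat_apply_lp(2)[OF _ coord_in_lp assms]) simp

lemma bounded_linear_l2_op:
  assumes A: "dominated A k" "schur k S"
  shows "bounded_linear (l2_op A)"
proof (rule bounded_linear_intro)
  fix x y and r :: real
  show "l2_op A (x + y) = l2_op A x + l2_op A y"
    by (rule l2_eqI)
       (simp add: coord_l2_op[OF A] mat_apply_add[OF A norm_coord_le norm_coord_le, symmetric] plus_l2.rep_eq)
  show "l2_op A (r *\<^sub>R x) = r *\<^sub>R l2_op A x"
    using mat_apply_scaleC[OF A norm_coord_le[of x], of "complex_of_real r"]
    by (intro l2_eqI) (simp add: coord_l2_op[OF A] scaleR_l2.rep_eq scaleC_of_real)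
  show "norm (l2_op A x) \<le> norm x * S"
    using norm_l2_op_le[OF A] by (simp add: mult.commute)
qed

definition l2_mult :: "('i \<Rightarrow> real) \<Rightarrow> ('i, 'a::real_inner) l2 \<Rightarrow> ('i, 'a) l2"
  where "l2_mult u x = Abs_l2 (\<lambda>i. u i *\<^sub>R coord x i)"

lemma coord_l2_mult:
  assumes u: "\<And>i. \<bar>u i\<bar> \<le> 1"
  shows "coord (l2_mult u x) i = u i *\<^sub>R coord x i"
proof -
  have "(\<lambda>i. (norm (u i *\<^sub>R coord x i))\<^sup>2) summable_on UNIV"
  proof (rule summable_on_comparison_test[OF coord_square_summable[of x]])
    show "(norm (u i *\<^sub>R coord x i))\<^sup>2 \<le> (norm (coord x i))\<^sup>2" for i
      using u[of i] by (intro power_mono) (auto intro: mult_left_le_one_le)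
  qed auto
  then show ?thesis by (simp add: l2_mult_def Abs_l2_inverse)
qed

lemma inner_l2_mult:
  assumes u: "\<And>i. \<bar>u i\<bar> \<le> 1"
  shows "inner (l2_mult u x) y = inner x (l2_mult u y)"
  unfolding inner_l2_eq by (simp add: coord_l2_mult[OF u])

lemma l2_mult_diff:
  assumes u: "\<And>i. \<bar>u i\<bar> \<le> 1"
  shows "l2_mult u (x - y) = l2_mult u x - l2_mult u y"
  by (rule l2_eqI) (simp add: coord_l2_mult[OF u] scaleR_diff_right)

text \<open>The spaces of families are treated as real Hilbert spaces; complex scalars act only as
  additional operators, with which matrices of complex linear entries commute.\<close>
definition l2_scaleC :: "complex \<Rightarrow> ('i, 'a::complex_hilbert) l2 \<Rightarrow> ('i, 'a) l2"
  where "l2_scaleC c x = Abs_l2 (\<lambda>i. c *\<^sub>C coord x i)"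

lemma coord_l2_scaleC: "coord (l2_scaleC c x) i = c *\<^sub>C coord x i"
proof -
  have "(\<lambda>i. (norm (c *\<^sub>C coord x i))\<^sup>2) summable_on UNIV"
    unfolding norm_scaleC power_mult_distrib
    by (intro summable_on_cmult_right coord_square_summable)
  then show ?thesis by (simp add: l2_scaleC_def Abs_l2_inverse)
qed

lemma inner_l2_scaleC: "inner (l2_scaleC c x) y = inner x (l2_scaleC (cnj c) y)"
  unfolding inner_l2_eq coord_l2_scaleC inner_scaleC_left ..

lemma l2_scaleC_diff: "l2_scaleC c (x - y) = l2_scaleC c x - l2_scaleC c y"
  by (rule l2_eqI)
     (simp add: coord_l2_scaleC linear_diff[OF bounded_linear.linear[OF bounded_linear_scaleC]])

lemma l2_op_scaleC:
  assumes A: "dominated A k" "schur k S"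
  shows "l2_op A (l2_scaleC c x) = l2_scaleC c (l2_op A x)"
proof (rule l2_eqI)
  fix i
  have "coord (l2_scaleC c x) = (\<lambda>i. c *\<^sub>C coord x i)" by (rule ext) (rule coord_l2_scaleC)
  then show "coord (l2_op A (l2_scaleC c x)) i = coord (l2_scaleC c (l2_op A x)) i"
    by (simp add: coord_l2_op[OF A] coord_l2_scaleC mat_apply_scaleC[OF A norm_coord_le])
qed

lemma single_scaleC: "single i (c *\<^sub>C v) = l2_scaleC c (single i v)"
  by (rule l2_eqI)
     (simp add: coord_single coord_l2_scaleC linear_0[OF bounded_linear.linear[OF bounded_linear_scaleC]])

lemma bounded_linear_single: "bounded_linear (single i)"
  by (rule bounded_linear_intro[where K = 1]) (auto intro: l2_eqI simp: coord_single)

section \<open>Localisation of the least squares solution\<close>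

text \<open>Let \<open>x\<close> be the solution for \<open>y\<close>, let \<open>r\<close> and \<open>s\<close> be the cutoff on rows and columns, and put
  \<open>v = s x\<close>. Conjugation gives \<open>r A x = (A - E) v\<close> and \<open>A s v = r (A - F) v\<close> with small defects
  \<open>E\<close> and \<open>F\<close>. The normal equation tested with \<open>s v\<close> becomes
  \<open>0 = \<langle>A x - y, r (A - F) v\<rangle> = \<langle>(A - E) v - r y, (A - F) v\<rangle>\<close>, where the multiplication operator
  \<open>r\<close> was moved to the left because it is self-adjoint. Hence \<open>\<parallel>A v\<parallel>^2\<close> is bounded by
  \<open>\<parallel>r y\<parallel> \<parallel>A v\<parallel>\<close>, up to terms that are absorbed on the left.\<close>
lemma weighted_least_squares:
  fixes A :: "('d::finite, 'x::complex_hilbert, 'y::complex_hilbert) op_matrix" and z :: "real ^ 'd"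
  assumes A: "dominated A (strong_decay \<alpha> C)" and C: "0 < C" and kA: "schur (strong_decay \<alpha> C :: int ^ 'd \<Rightarrow> int ^ 'd \<Rightarrow> real) S0"
    and \<kappa>: "0 < \<kappa>" "\<And>x. \<kappa> * norm x \<le> norm (l2_op A x)"
    and \<epsilon>: "0 < \<epsilon>" "\<epsilon> \<le> 1" and kE: "schur (slanted_decay \<alpha> (\<epsilon> * C) :: int ^ 'd \<Rightarrow> int ^ 'd \<Rightarrow> real) (\<kappa> / 4)"
  shows "\<kappa> * norm (l2_mult (\<lambda>n. cutoff \<epsilon> z (node 1 n)) (least_squares (l2_op A) y))
    \<le> 3 * norm (l2_mult (\<lambda>m. cutoff \<epsilon> z (node \<alpha> m)) y)"
proof -
  define r where "r = (\<lambda>m :: int ^ 'd. cutoff \<epsilon> z (node \<alpha> m))"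
  define s where "s = (\<lambda>n :: int ^ 'd. cutoff \<epsilon> z (node 1 n))"
  have rs: "r m \<noteq> 0" "s m \<noteq> 0" "\<bar>r m\<bar> \<le> 1" "\<bar>s m\<bar> \<le> 1" for m
    using cutoff_pos[of \<epsilon> z] cutoff_le_1[of \<epsilon> z] by (auto simp: r_def s_def less_imp_le less_imp_neq[symmetric])
  define x where "x = least_squares (l2_op A) y"
  define v where "v = l2_mult s x"
  define E where "E = entry_defect (\<lambda>m n. r m / s n) A"
  define F where "F = entry_defect (\<lambda>m n. s n / r m) A"
  have E: "dominated E (slanted_decay \<alpha> (\<epsilon> * C))"
    unfolding E_def r_def s_def by (rule dominated_entry_defect[OF A C cutoff_ratio[OF \<epsilon>]])
  have F: "dominated F (slanted_decay \<alpha> (\<epsilon> * C))"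
    unfolding F_def r_def s_def
    by (rule dominated_entry_defect[OF A C]) (use cutoff_ratio[OF \<epsilon>] in \<open>simp add: weight_diff_commute\<close>)
  define Tv where "Tv = l2_op A v"
  define Ev where "Ev = l2_op E v"
  define Fv where "Fv = l2_op F v"
  define Y where "Y = l2_mult r y"
  have 1: "l2_mult r (l2_op A x) = Tv - Ev"
  proof (rule l2_eqI)
    fix m
    show "coord (l2_mult r (l2_op A x)) m = coord (Tv - Ev) m"
      unfolding coord_l2_mult[OF rs(3)] Tv_def Ev_def coord_simps coord_l2_op[OF A kA]
        coord_l2_op[OF E kE]
      unfolding E_def
      by (rule mat_apply_entry_defect[OF A kA E[unfolded E_def] kE norm_coord_le, symmetric])
         (simp add: v_def coord_l2_mult[OF rs(4)] rs)
  qed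
  have 2: "l2_op A (l2_mult s v) = l2_mult r (Tv - Fv)"
  proof (rule l2_eqI)
    fix m
    have "coord (Tv - Fv) m = (1 / r m) *\<^sub>R mat_apply A (coord (l2_mult s v)) m"
      unfolding Tv_def Fv_def coord_simps coord_l2_op[OF A kA] coord_l2_op[OF F kE]
      unfolding F_def
      by (rule mat_apply_entry_defect[OF A kA F[unfolded F_def] kE norm_coord_le])
         (simp add: coord_l2_mult[OF rs(4)])
    then show "coord (l2_op A (l2_mult s v)) m = coord (l2_mult r (Tv - Fv)) m"
      by (simp add: coord_l2_mult[OF rs(3)] coord_l2_op[OF A kA] rs)
  qed
  have "0 = inner (l2_op A x - y) (l2_op A (l2_mult s v))"
    unfolding x_def by (rule least_squares_normal[OF bounded_linear_l2_op[OF A kA] \<kappa>, symmetric])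
  also have "\<dots> = inner (l2_mult r (l2_op A x - y)) (Tv - Fv)"
    unfolding 2 by (rule inner_l2_mult[OF rs(3), symmetric])
  also have "l2_mult r (l2_op A x - y) = Tv - Ev - Y"
    by (simp add: l2_mult_diff[OF rs(3)] 1 Y_def)
  also have "inner (Tv - Ev - Y) (Tv - Fv) = inner Tv Tv - inner Tv Fv - inner Ev Tv + inner Ev Fv - inner Y Tv + inner Y Fv"
    by (simp add: inner_diff_left inner_diff_right)
  finally have eq: "(norm Tv)\<^sup>2 = inner Tv Fv + inner Ev Tv - inner Ev Fv + inner Y Tv - inner Y Fv"
    by (simp add: power2_norm_eq_inner)
  define a where "a = norm Tv"
  have v: "\<kappa> * norm v \<le> a" unfolding a_def Tv_def by (rule \<kappa>(2))
  have Ea: "norm Ev \<le> a / 4" using norm_l2_op_le[OF E kE, of v] v by (simp add: Ev_def)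
  have Fa: "norm Fv \<le> a / 4" using norm_l2_op_le[OF F kE, of v] v by (simp add: Fv_def)
  have a: "0 \<le> a" by (simp add: a_def)
  have cs: "\<bar>inner p q\<bar> \<le> b * c" if "norm p \<le> b" "norm q \<le> c" for p q :: "(int ^ 'd, 'y) l2" and b c
    using Cauchy_Schwarz_ineq2[of p q] mult_mono[OF that order_trans[OF norm_ge_zero that(1)] norm_ge_zero]
    by linarith
  have T: "norm Tv \<le> a" by (simp add: a_def)
  have "a * a \<le> a * (a / 4) + a / 4 * a + a / 4 * (a / 4) + norm Y * a + norm Y * (a / 4)"
    using eq cs[OF T Fa] cs[OF Ea T] cs[OF Ea Fa] cs[OF order_refl[of "norm Y"] T]
      cs[OF order_refl[of "norm Y"] Fa]
    unfolding a_def[symmetric] power2_eq_square by linarith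
  then have "a * (7 / 16 * a) \<le> a * (5 / 4 * norm Y)"
    by (simp add: algebra_simps)
  then have "7 / 16 * a \<le> 5 / 4 * norm Y"
    using a by (cases "a = 0") (auto simp: mult_le_cancel_left_pos)
  then have "a \<le> 3 * norm Y" using norm_ge_zero[of Y] by linarith
  then show ?thesis
    using v unfolding v_def x_def Y_def r_def s_def by linarith
qed

text \<open>The columns of \<open>B\<close> are the least squares solutions for right-hand sides at a single row
  \<open>m\<close>. On such a family the row cutoff is a scalar, so the weighted estimate with center \<open>i\<close> is a
  decay estimate for the entry \<open>(i, m)\<close>. The identity \<open>B A = 1\<close> is read off column by column: a
  column of \<open>A\<close> is absolutely summable, hence an \<open>l^2\<close>-convergent sum of such families.\<close>
theorem left_inverse_exists:
  fixes A :: "('d::finite, 'x::complex_hilbert, 'y::complex_hilbert) op_matrix"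
  assumes \<alpha>: "\<alpha> \<noteq> 0" and A: "dominated A (strong_decay \<alpha> C)" and C: "0 < C"
    and below: "bounded_below_lp 2 A"
  obtains B D where "0 < D" "dominated B (\<lambda>i m. slanted_decay \<alpha> D m i)"
    "\<And>i n v. (\<Sum>\<^sub>\<infinity>m. B i m (A m n v)) = (if i = n then v else 0)"
proof -
  obtain S where S: "\<And>C. 0 < C \<Longrightarrow> schur (slanted_decay \<alpha> C :: int ^ 'd \<Rightarrow> int ^ 'd \<Rightarrow> real) (C * S)"
    "\<And>C. 0 < C \<Longrightarrow> schur (strong_decay \<alpha> C :: int ^ 'd \<Rightarrow> int ^ 'd \<Rightarrow> real) (C * S)" "0 < S"
    by (rule schur_decay[OF \<alpha>, where 'd='d]) (rule that)
  note kA = S(2)[OF C]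
  obtain \<kappa>0 where \<kappa>0: "0 < \<kappa>0" "\<And>x. x \<in> lp 2 \<Longrightarrow> \<kappa>0 * lp_norm 2 x \<le> lp_norm 2 (mat_apply A x)"
    using below by (auto simp: bounded_below_lp_def)
  \<comment> \<open>The lower bound is decreased if necessary, so that the \<open>\<epsilon>\<close> below is at most 1.\<close>
  define \<kappa> where "\<kappa> = min \<kappa>0 (4 * (C * S))"
  have \<kappa>: "0 < \<kappa>" "\<kappa> \<le> 4 * (C * S)" using \<kappa>0 C S by (auto simp: \<kappa>_def)
  have T: "\<kappa> * norm x \<le> norm (l2_op A x)" for x
  proof -
    have "\<kappa> * norm x \<le> \<kappa>0 * norm x" by (intro mult_right_mono) (auto simp: \<kappa>_def)
    also have "\<dots> \<le> norm (l2_op A x)"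
      unfolding norm_l2_lp coord_l2_op[OF A kA] by (rule \<kappa>0(2)[OF coord_in_lp])
    finally show ?thesis .
  qed
  define \<epsilon> where "\<epsilon> = \<kappa> / (4 * (C * S))"
  have \<epsilon>: "0 < \<epsilon>" "\<epsilon> \<le> 1" "\<epsilon> * C * S = \<kappa> / 4" using \<kappa> C S by (auto simp: \<epsilon>_def)
  have kE: "schur (slanted_decay \<alpha> (\<epsilon> * C) :: int ^ 'd \<Rightarrow> int ^ 'd \<Rightarrow> real) (\<kappa> / 4)"
    using S(1)[of "\<epsilon> * C"] \<epsilon> C by simp
  define N where "N = 1 / \<epsilon> ^ (2 * CARD('d))"
  have N: "0 < N" using \<epsilon> by (simp add: N_def)
  define L where "L = least_squares (l2_op A)"
  note linA = bounded_linear_l2_op[OF A kA]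
  have L: "bounded_linear L" unfolding L_def by (rule bounded_linear_least_squares[OF linA \<kappa>(1) T])
  have LC: "L (l2_scaleC c y) = l2_scaleC c (L y)" for c y
    unfolding L_def
  proof (rule least_squares_eqI[OF linA \<kappa>(1) T])
    show "inner (l2_op A (l2_scaleC c (least_squares (l2_op A) y)) - l2_scaleC c y) (l2_op A z) = 0" for z
      unfolding l2_op_scaleC[OF A kA] l2_scaleC_diff[symmetric] inner_l2_scaleC
      unfolding l2_op_scaleC[OF A kA, symmetric] by (rule least_squares_normal[OF linA \<kappa>(1) T])
  qed
  define B where "B = (\<lambda>i m w. coord (L (single m w)) i)"
  show thesis
  proof (rule that[of "3 / \<kappa> * N" B])
    show "0 < 3 / \<kappa> * N" using \<kappa> N by simp
    show "dominated B (\<lambda>i m. slanted_decay \<alpha> (3 / \<kappa> * N) m i)"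
      unfolding dominated_def
    proof (intro conjI allI)
      fix i m
      show "bounded_clinear (B i m)"
        unfolding bounded_clinear_def B_def
      proof (intro conjI allI)
        show "bounded_linear (\<lambda>w. coord (L (single m w)) i)"
          by (intro bounded_linear_compose[OF bounded_linear_coord] bounded_linear_compose[OF L]
              bounded_linear_single)
      qed (simp add: single_scaleC LC coord_l2_scaleC)
      fix w :: 'y
      define z where "z = (node 1 i :: real ^ 'd)"
      have c1: "\<bar>cutoff \<epsilon> z (node \<beta> n)\<bar> \<le> 1" for \<beta> n
        using cutoff_pos[of \<epsilon> z "node \<beta> n"] cutoff_le_1[of \<epsilon> z "node \<beta> n"] by simp
      have zi: "cutoff \<epsilon> z (node 1 i) = 1" by (simp add: z_def)
      have row: "l2_mult (\<lambda>m. cutoff \<epsilon> z (node \<alpha> m)) (single m w) = cutoff \<epsilon> z (node \<alpha> m) *\<^sub>R single m w"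
        by (rule l2_eqI) (simp add: coord_l2_mult[OF c1] coord_single)
      have "coord (l2_mult (\<lambda>n. cutoff \<epsilon> z (node 1 n)) (L (single m w))) i = B i m w"
        by (simp add: coord_l2_mult[OF c1] B_def zi)
      then have "\<kappa> * norm (B i m w) \<le> \<kappa> * norm (l2_mult (\<lambda>n. cutoff \<epsilon> z (node 1 n)) (L (single m w)))"
        using norm_coord_le[of "l2_mult (\<lambda>n. cutoff \<epsilon> z (node 1 n)) (L (single m w))" i] \<kappa>(1)
        by (simp add: mult_le_cancel_left_pos)
      also have "\<dots> \<le> 3 * norm (l2_mult (\<lambda>m. cutoff \<epsilon> z (node \<alpha> m)) (single m w))"
        unfolding L_def by (rule weighted_least_squares[OF A C kA \<kappa>(1) T \<epsilon>(1,2) kE])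
      also have "\<dots> = 3 * (cutoff \<epsilon> z (node \<alpha> m) * norm w)"
        using cutoff_pos[of \<epsilon> z "node \<alpha> m"] by (simp add: row)
      also have "\<dots> \<le> 3 * (slanted_decay \<alpha> N m i * norm w)"
        using cutoff_le[OF \<epsilon>(1,2), of z "node \<alpha> m"]
        by (intro mult_left_mono mult_right_mono) (auto simp: slanted_decay_def N_def z_def)
      finally have "norm (B i m w) \<le> 3 * (slanted_decay \<alpha> N m i * norm w) / \<kappa>"
        using \<kappa>(1) by (simp add: pos_le_divide_eq mult.commute)
      then show "norm (B i m w) \<le> slanted_decay \<alpha> (3 / \<kappa> * N) m i * norm w"
        by (simp add: slanted_decay_def mult_ac)
    qed
    fix i n :: "int ^ 'd" and v :: 'x
    have col: "coord (l2_op A (single n v)) m = A m n v" for m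
    proof -
      have "coord (l2_op A (single n v)) m = (\<Sum>\<^sub>\<infinity>n'. A m n' (coord (single n v) n'))"
        by (simp add: coord_l2_op[OF A kA] mat_apply_def)
      also have "\<dots> = (\<Sum>\<^sub>\<infinity>n'\<in>{n}. A m n' (coord (single n v) n'))"
        by (rule infsum_cong_neutral)
           (auto simp: coord_single linear_0[OF bounded_linear.linear[OF dominated_linear[OF A]]])
      also have "\<dots> = A m n v" by (simp add: coord_single)
      finally show ?thesis .
    qed
    have "(\<lambda>m. strong_decay \<alpha> C m n * norm v) summable_on UNIV"
      by (intro summable_on_cmult_left schur_row(1)[OF schur_transpose[OF kA]])
    then have "(\<lambda>m. norm (coord (l2_op A (single n v)) m)) summable_on UNIV"
      unfolding col by (rule summable_on_comparison_test) (auto intro: dominated_le[OF A])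
    from has_sum_single_coord[OF this]
    have "((\<lambda>m. single m (A m n v)) has_sum l2_op A (single n v)) UNIV"
      unfolding col .
    from has_sum_bounded_linear[OF bounded_linear_compose[OF bounded_linear_coord L] this]
    have "((\<lambda>m. B i m (A m n v)) has_sum coord (L (l2_op A (single n v))) i) UNIV"
      unfolding o_def B_def .
    moreover have "L (l2_op A (single n v)) = single n v"
      unfolding L_def by (rule least_squares_inverse[OF linA \<kappa>(1) T])
    ultimately show "(\<Sum>\<^sub>\<infinity>m. B i m (A m n v)) = (if i = n then v else 0)"
      by (simp add: infsumI coord_single)
  qed
qed

section \<open>Decay of slanted matrices with polynomial weight\<close>

text \<open>All coordinates of \<open>x\<close> are at most \<open>1 + \<bar>j\<bar>\<close>, so \<open>(weight x)^2\<close> is at most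
  \<open>(2 (1 + \<bar>j\<bar>)) ^ (4 d)\<close>; and \<open>4 d \<le> (d + 1)^2\<close> because \<open>(d - 1)^2 \<ge> 0\<close>.\<close>
lemma weight_le_poly_weight:
  fixes x :: "real ^ 'd::finite" and j :: "int ^ 'd"
  assumes s: "(real CARD('d) + 1)\<^sup>2 < s" and j: "\<And>k. \<bar>x $ k\<bar> \<le> \<bar>real_of_int (j $ k)\<bar> + 1"
  shows "(weight x)\<^sup>2 \<le> 2 ^ (4 * CARD('d)) * poly_weight s j"
proof -
  define M where "M = real_of_int (max_abs j)"
  have M: "\<bar>real_of_int (j $ k)\<bar> \<le> M" for k
  proof -
    have "\<bar>j $ k\<bar> \<le> max_abs j" unfolding max_abs_def by (intro Max_ge) auto
    then show ?thesis unfolding M_def by (metis of_int_abs of_int_le_iff)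
  qed
  have M0: "0 \<le> M" using M[of undefined] by linarith
  have "(weight x)\<^sup>2 = (\<Prod>k\<in>UNIV. (1 + \<bar>x $ k\<bar>) ^ 4)"
    by (simp add: weight_def prod_power_distrib[symmetric] power_mult[symmetric])
  also have "\<dots> \<le> (\<Prod>k\<in>(UNIV :: 'd set). (2 * (1 + M)) ^ 4)"
  proof (intro prod_mono conjI power_mono)
    show "1 + \<bar>x $ k\<bar> \<le> 2 * (1 + M)" for k using j[of k] M[of k] M0 by simp
  qed auto
  also have "\<dots> = 2 ^ (4 * CARD('d)) * (1 + M) ^ (4 * CARD('d))"
    by (simp only: prod_constant power_mult[symmetric] power_mult_distrib)
  also have "(1 + M) ^ (4 * CARD('d)) = (1 + M) powr (real (4 * CARD('d)))"
    by (rule powr_realpow[symmetric]) (use M0 in linarith)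
  also have "\<dots> \<le> (1 + M) powr s"
  proof (rule powr_mono)
    have "4 * real CARD('d) \<le> (real CARD('d) + 1)\<^sup>2"
      using zero_le_power2[of "real CARD('d) - 1"] by (simp add: power2_eq_square algebra_simps)
    then show "real (4 * CARD('d)) \<le> s" using s by simp
  qed (use M0 in simp)
  finally show ?thesis by (simp add: poly_weight_def M_def)
qed

text \<open>The entry \<open>(m, n)\<close> belongs to the slant whose index is the integer part of \<open>\<alpha> m - n\<close>. A
  single term of the convergent series of slants already bounds it.\<close>
lemma slant_class_dominated:
  fixes A :: "('d::finite, 'x::complex_hilbert, 'y::complex_hilbert) op_matrix"
  assumes \<alpha>: "\<alpha> \<noteq> 0" and s: "(real CARD('d) + 1)\<^sup>2 < s"
    and A: "A \<in> slant_class \<alpha> (poly_weight s)"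
  obtains C where "0 < C" "dominated A (strong_decay \<alpha> C)"
proof -
  define T where "T = (\<Sum>\<^sub>\<infinity>j. sup_norm (slant \<alpha> j A) * ennreal (poly_weight s j))"
  define K where "K = nat \<lceil>1 / \<bar>\<alpha>\<bar>\<rceil> ^ CARD('d)"
  have lin: "bounded_clinear (A m n)" for m n using A by (simp add: slant_class_def)
  have "0 < \<lceil>1 / \<bar>\<alpha>\<bar>\<rceil>" using \<alpha> by simp
  then have "0 < nat \<lceil>1 / \<bar>\<alpha>\<bar>\<rceil>" by (simp only: zero_less_nat_eq)
  then have "1 \<le> K" unfolding K_def by (intro one_le_power) linarith
  then have "(1 :: ennreal) \<le> of_nat K" by (metis of_nat_1 of_nat_mono)
  then have "T \<le> of_nat K * T" using mult_right_mono[of 1 "of_nat K :: ennreal" T] by simp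
  also have "\<dots> < \<infinity>" using A by (simp add: slant_class_def slant_norm_def T_def K_def)
  finally have T: "T < \<infinity>" .
  define C0 where "C0 = enn2real T"
  have C0: "0 \<le> C0" "ennreal C0 = T" using T by (simp_all add: C0_def)
  define C where "C = (C0 + 1) * 2 ^ (4 * CARD('d))"
  show thesis
  proof (rule that[of C])
    show "0 < C" using C0 by (simp add: C_def)
    show "dominated A (strong_decay \<alpha> C)"
      unfolding dominated_def
    proof (intro conjI allI lin)
      fix m n and v :: 'x
      define j :: "int ^ 'd" where "j = (\<chi> k. \<lfloor>\<alpha> * real_of_int (m $ k) - real_of_int (n $ k)\<rfloor>)"
      define x :: "real ^ 'd" where "x = node \<alpha> m - node 1 n"
      have xk: "x $ k = \<alpha> * real_of_int (m $ k) - real_of_int (n $ k)" for k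
        by (simp add: x_def node_def)
      have pw: "0 \<le> poly_weight s j" by (simp add: poly_weight_def)
      have jx: "real_of_int (j $ k) \<le> x $ k" "x $ k < real_of_int (j $ k) + 1" for k
        by (simp_all add: xk j_def)
      then have "slant \<alpha> j A m n = A m n"
        by (simp add: slant_def[abs_def] xk[symmetric])
      then have "ennreal (onorm (A m n)) \<le> sup_norm (slant \<alpha> j A)"
        unfolding sup_norm_def by (intro SUP_upper2[of m] SUP_upper2[of n]) auto
      then have "ennreal (onorm (A m n)) * ennreal (poly_weight s j)
          \<le> sup_norm (slant \<alpha> j A) * ennreal (poly_weight s j)"
        by (rule mult_right_mono) simp
      also have "\<dots> = (\<Sum>\<^sub>\<infinity>j\<in>{j}. sup_norm (slant \<alpha> j A) * ennreal (poly_weight s j))"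
        by simp
      also have "\<dots> \<le> T"
        unfolding T_def by (rule infsum_mono_neutral) (auto intro!: nonneg_summable_on_complete)
      finally have 1: "onorm (A m n) * poly_weight s j \<le> C0"
        unfolding C0(2)[symmetric] ennreal_mult[OF onorm_pos_le[OF bounded_clinear_linear[OF lin]] pw, symmetric]
        by (simp only: ennreal_le_iff[OF C0(1)])
      have "(weight x)\<^sup>2 \<le> 2 ^ (4 * CARD('d)) * poly_weight s j"
      proof (rule weight_le_poly_weight[OF s])
        show "\<bar>x $ k\<bar> \<le> \<bar>real_of_int (j $ k)\<bar> + 1" for k using jx[of k] by linarith
      qed
      then have "onorm (A m n) * (weight x)\<^sup>2 \<le> onorm (A m n) * (2 ^ (4 * CARD('d)) * poly_weight s j)"
        by (intro mult_left_mono onorm_pos_le bounded_clinear_linear lin)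
      also have "\<dots> \<le> C0 * 2 ^ (4 * CARD('d))"
        using mult_right_mono[OF 1, of "2 ^ (4 * CARD('d))"] by (simp add: mult_ac)
      also have "\<dots> \<le> C" by (simp add: C_def)
      finally have "onorm (A m n) \<le> strong_decay \<alpha> C m n"
        using weight_pos[of x] by (simp add: strong_decay_def x_def[symmetric] pos_le_divide_eq)
      then have "onorm (A m n) * norm v \<le> strong_decay \<alpha> C m n * norm v"
        by (rule mult_right_mono) simp
      then show "norm (A m n v) \<le> strong_decay \<alpha> C m n * norm v"
        using onorm[OF bounded_clinear_linear[OF lin], of m n v] by linarith
    qed
  qed
qed

section \<open>The range of a left invertible matrix\<close>

text \<open>The projection is \<open>A B\<close>; since \<open>B A = 1\<close>, it is idempotent and fixes the range of \<open>A\<close>.\<close>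
lemma range_complementable:
  fixes A :: "('d::finite, 'x::complex_hilbert, 'y::complex_hilbert) op_matrix"
  assumes A: "dominated A k" and k: "schur k S" and B: "dominated B h" and h: "schur h T"
    and BA: "\<And>i n v. (\<Sum>\<^sub>\<infinity>m. B i m (A m n v)) = (if i = n then v else 0)" and q: "1 \<le> q"
  shows "complementable_lp q (mat_apply A ` lp q)"
proof -
  have inv: "mat_apply B (mat_apply A x) = x" if x: "x \<in> lp q" for x
  proof
    fix i
    have "mat_apply B (mat_apply A x) i = (\<Sum>\<^sub>\<infinity>n. if i = n then x n else 0)"
      unfolding mat_apply_mat_apply[OF B h A k norm_le_lp_norm[OF q x]] BA ..
    also have "\<dots> = (\<Sum>\<^sub>\<infinity>n\<in>{i}. x n)" by (rule infsum_cong_neutral) auto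
    finally show "mat_apply B (mat_apply A x) i = x i" by simp
  qed
  note Alp = mat_apply_lp[OF q _ A k] and Blp = mat_apply_lp[OF q _ B h]
  define P where "P = (\<lambda>y. mat_apply A (mat_apply B y))"
  have "bounded_projection_lp q P"
    unfolding bounded_projection_lp_def
  proof (intro conjI ballI allI)
    show "P ` lp q \<subseteq> lp q" using Alp(1) Blp(1) by (auto simp: P_def)
    show "P (\<lambda>n. y n + z n) = (\<lambda>n. P y n + P z n)" if y: "y \<in> lp q" and z: "z \<in> lp q" for y z
    proof -
      have "mat_apply B (\<lambda>n. y n + z n) = (\<lambda>n. mat_apply B y n + mat_apply B z n)"
        by (rule ext) (rule mat_apply_add[OF B h norm_le_lp_norm[OF q y] norm_le_lp_norm[OF q z]])
      then show ?thesis
        unfolding P_def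
        by (simp only:) (intro ext mat_apply_add[OF A k norm_le_lp_norm[OF q Blp(1)[OF y]]
              norm_le_lp_norm[OF q Blp(1)[OF z]]])
    qed
    show "P (\<lambda>n. c *\<^sub>C y n) = (\<lambda>n. c *\<^sub>C P y n)" if y: "y \<in> lp q" for c y
    proof -
      have "mat_apply B (\<lambda>n. c *\<^sub>C y n) = (\<lambda>n. c *\<^sub>C mat_apply B y n)"
        by (rule ext) (rule mat_apply_scaleC[OF B h norm_le_lp_norm[OF q y]])
      then show ?thesis
        unfolding P_def
        by (simp only:) (intro ext mat_apply_scaleC[OF A k norm_le_lp_norm[OF q Blp(1)[OF y]]])
    qed
    have "lp_norm q (P y) \<le> S * T * lp_norm q y" if y: "y \<in> lp q" for y
    proof -
      have "lp_norm q (P y) \<le> S * lp_norm q (mat_apply B y)"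
        unfolding P_def by (rule Alp(2)[OF Blp(1)[OF y]])
      also have "\<dots> \<le> S * (T * lp_norm q y)"
        using schur_pos[OF k] by (intro mult_left_mono Blp(2)[OF y]) simp
      finally show ?thesis by (simp add: mult.assoc)
    qed
    then show "\<exists>C. \<forall>y\<in>lp q. lp_norm q (P y) \<le> C * lp_norm q y" by blast
    show "P (P y) = P y" if "y \<in> lp q" for y
      unfolding P_def inv[OF Blp(1)[OF that]] ..
  qed
  moreover have "P ` lp q = mat_apply A ` lp q"
  proof
    show "P ` lp q \<subseteq> mat_apply A ` lp q" using Blp(1) by (auto simp: P_def)
    show "mat_apply A ` lp q \<subseteq> P ` lp q"
    proof
      fix y assume "y \<in> mat_apply A ` lp q"
      then obtain x where x: "x \<in> lp q" "y = mat_apply A x" by blast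
      then have "y = P y" by (simp add: P_def inv)
      then show "y \<in> P ` lp q" using Alp(1)[OF x(1)] x(2) by blast
    qed
  qed
  ultimately show ?thesis unfolding complementable_lp_def by blast
qed

theorem corollary2p12:
  fixes \<alpha> s :: real
    and A :: "('d::finite, 'x::complex_hilbert, 'y::complex_hilbert) op_matrix"
  assumes "\<alpha> \<noteq> 0"
    and "separable_space (euclidean :: 'x topology)"
    and "separable_space (euclidean :: 'y topology)"
    and "s > (real CARD('d) + 1)\<^sup>2"
    and "A \<in> slant_class \<alpha> (poly_weight s)"
    and "\<exists>p\<in>{1..\<infinity>}. bounded_below_lp p A"
  shows "\<forall>q\<in>{1..\<infinity>}. complementable_lp q (mat_apply A ` lp q)"
proof
  fix q :: ereal assume "q \<in> {1..\<infinity>}"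
  then have q: "1 \<le> q" by simp
  obtain p where p: "1 \<le> p" "bounded_below_lp p A" using assms(6) by auto
  obtain C where C: "0 < C" and A: "dominated A (strong_decay \<alpha> C)"
    using slant_class_dominated[OF assms(1,4,5)] .
  have below: "bounded_below_lp 2 A"
    by (rule bounded_below_lp_independent[OF assms(1) A C p]) simp
  obtain B D where D: "0 < D" and B: "dominated B (\<lambda>i m. slanted_decay \<alpha> D m i)"
    and BA: "\<And>i n v. (\<Sum>\<^sub>\<infinity>m. B i m (A m n v)) = (if i = n then v else 0)"
    by (rule left_inverse_exists[OF assms(1) A C below]) (rule that)
  obtain S where S: "\<And>C. 0 < C \<Longrightarrow> schur (slanted_decay \<alpha> C :: int ^ 'd \<Rightarrow> int ^ 'd \<Rightarrow> real) (C * S)"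
    "\<And>C. 0 < C \<Longrightarrow> schur (strong_decay \<alpha> C :: int ^ 'd \<Rightarrow> int ^ 'd \<Rightarrow> real) (C * S)" "0 < S"
    by (rule schur_decay[OF assms(1), where 'd='d]) (rule that)
  show "complementable_lp q (mat_apply A ` lp q)"
    by (rule range_complementable[OF A S(2)[OF C] B schur_transpose[OF S(1)[OF D]] BA q])
qed

end
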